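(* Let $\Omega\subset\mathbb{R}^d$ be a nonempty bounded open set. Let $\mathcal{L}$ be a symmetric Lévy operator on $\mathbb{R}^d$ with Lévy measure $\mu$ and multiplier $m(\xi)=\int_{\mathbb{R}^d}(1-\cos(\xi\cdot z))\,\mathrm{d}\mu(z)$. Then the embedding $H^{\mathcal{L}}_0(\Omega)\hookrightarrow L^2(\Omega)$ is compact if, and only if, $$\liminf_{|\xi|\to\infty}m(\xi)=\infty.$$
   Context: A symmetric Lévy operator on $\mathbb{R}^d$ is an operator $\mathcal{L}[\phi](x)=\lim_{\epsilon\to0}\int_{|z|>\epsilon}(\phi(x+z)-\phi(x))\,\mathrm{d}\mu(z)$, $\phi\in C_c^\infty(\mathbb{R}^d)$, where its Lévy measure $\mu$ is a nonnegative Borel measure on $\mathbb{R}^d$ with $\mu(E)=\mu(-E)$ for all Borel $E$, $\mu(\{0\})=0$ and $\int_{\mathbb{R}^d}\min\{|z|^2,1\}\,\mathrm{d}\mu(z)<\infty$. The associated bilinear operator satisfies $\mathcal{B}[\phi,\phi](x)=\frac12\int_{\mathbb{R}^d}(\phi(x+z)-\phi(x))^2\,\mathrm{d}\mu(z)\in[0,\infty]$. $L^2(\Omega)$ is identified with a subspace of $L^2(\mathbb{R}^d)$ through extension by zero, and $H^{\mathcal{L}}_0(\Omega)\subseteq L^2(\Omega)$ is the subspace of all $\phi\in L^2(\Omega)$ with $$\|\phi\|_{H_0^{\mathcal{L}}(\Omega)}^2:=\|\phi\|_{L^2(\Omega)}^2+\int_{\mathbb{R}^d}\mathcal{B}[\phi,\phi]\,\mathrm{d}x<\infty,$$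 equipped with this norm. *)

theory Defs
  imports "HOL-Analysis.Analysis"
begin

text \<open>Real-valued functions of class \<open>C\<^sup>k\<close> on the whole space, by recursion on directional
  derivatives. Every direction is required at each level, which amounts to all partial
  derivatives up to order \<open>k\<close> existing and being continuous.\<close>

primrec C_k :: "nat \<Rightarrow> ('a::euclidean_space \<Rightarrow> real) \<Rightarrow> bool" where
  "C_k 0 f \<longleftrightarrow> continuous_on UNIV f"
| "C_k (Suc k) f \<longleftrightarrow>
     (\<forall>x. f differentiable at x) \<and> (\<forall>v. C_k k (\<lambda>x. frechet_derivative f (at x) v))"

definition test_functions :: "('a::euclidean_space \<Rightarrow> real) set" where
  "test_functions = {\<phi>. (\<forall>k. C_k k \<phi>) \<and> compact (closure {x. \<phi> x \<noteq> 0})}"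

definition symmetric_levy_measure :: "'a::euclidean_space measure \<Rightarrow> bool" where
  "symmetric_levy_measure \<mu> \<longleftrightarrow>
     sets \<mu> = sets borel \<and>
     (\<forall>E\<in>sets borel. emeasure \<mu> (uminus ` E) = emeasure \<mu> E) \<and>
     emeasure \<mu> {0} = 0 \<and>
     (\<integral>\<^sup>+z. ennreal (min ((norm z)\<^sup>2) 1) \<partial>\<mu>) < \<infinity>"

text \<open>The operator is determined only on test functions; its values elsewhere are irrelevant.\<close>

definition symmetric_levy_operator ::
    "(('a::euclidean_space \<Rightarrow> real) \<Rightarrow> 'a \<Rightarrow> real) \<Rightarrow> 'a measure \<Rightarrow> bool" where
  "symmetric_levy_operator L \<mu> \<longleftrightarrow>
     symmetric_levy_measure \<mu> \<and>
     (\<forall>\<phi>\<in>test_functions. \<forall>x.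
        ((\<lambda>\<epsilon>. LINT z:{z. norm z > \<epsilon>}|\<mu>. \<phi> (x + z) - \<phi> x) \<longlongrightarrow> L \<phi> x) (at_right 0))"

text \<open>For a symmetric Levy measure the integrand is dominated by a multiple of
  \<open>min \<bar>z\<bar>\<^sup>2 1\<close>, so this Bochner integral exists for every \<open>\<xi>\<close>.\<close>

definition levy_multiplier :: "'a::euclidean_space measure \<Rightarrow> 'a \<Rightarrow> real" where
  "levy_multiplier \<mu> \<xi> = (LINT z|\<mu>. 1 - cos (\<xi> \<bullet> z))"

text \<open>The diagonal \<open>B[\<phi>,\<phi>]\<close> of the associated bilinear operator.\<close>

definition levy_B :: "'a::euclidean_space measure \<Rightarrow> ('a \<Rightarrow> real) \<Rightarrow> 'a \<Rightarrow> ennreal" where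
  "levy_B \<mu> \<phi> x = (1/2) * (\<integral>\<^sup>+z. ennreal ((\<phi> (x + z) - \<phi> x)\<^sup>2) \<partial>\<mu>)"

text \<open>Elements of \<open>L\<^sup>2\<close> are represented by Borel functions on the whole space; functions that
  agree almost everywhere represent the same element, and all notions below are invariant
  under such changes. Borel (rather than Lebesgue) measurability makes
  \<open>(x, z) \<mapsto> \<phi> (x + z)\<close> measurable for the product with an arbitrary Levy measure, and every
  class has a Borel representative. Extension by zero becomes vanishing almost
  everywhere outside \<open>\<Omega>\<close>.\<close>

definition L2_nn :: "('a::euclidean_space \<Rightarrow> real) \<Rightarrow> ennreal" where
  "L2_nn \<phi> = (\<integral>\<^sup>+x. ennreal ((\<phi> x)\<^sup>2) \<partial>lborel)"

definition L2 :: "'a::euclidean_space set \<Rightarrow> ('a \<Rightarrow> real) set" where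
  "L2 \<Omega> = {\<phi> \<in> borel_measurable borel.
            (AE x in lborel. x \<notin> \<Omega> \<longrightarrow> \<phi> x = 0) \<and> L2_nn \<phi> < \<infinity>}"

definition L2_norm :: "('a::euclidean_space \<Rightarrow> real) \<Rightarrow> real" where
  "L2_norm \<phi> = sqrt (enn2real (L2_nn \<phi>))"

definition H0_nn :: "'a::euclidean_space measure \<Rightarrow> ('a \<Rightarrow> real) \<Rightarrow> ennreal" where
  "H0_nn \<mu> \<phi> = L2_nn \<phi> + (\<integral>\<^sup>+x. levy_B \<mu> \<phi> x \<partial>lborel)"

definition H0 :: "'a::euclidean_space measure \<Rightarrow> 'a set \<Rightarrow> ('a \<Rightarrow> real) set" where
  "H0 \<mu> \<Omega> = {\<phi> \<in> L2 \<Omega>. H0_nn \<mu> \<phi> < \<infinity>}"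

definition H0_norm :: "'a::euclidean_space measure \<Rightarrow> ('a \<Rightarrow> real) \<Rightarrow> real" where
  "H0_norm \<mu> \<phi> = sqrt (enn2real (H0_nn \<mu> \<phi>))"

text \<open>Compactness of the inclusion of \<open>(X, nX)\<close> into \<open>(Y, nY)\<close>: every bounded sequence in \<open>X\<close> has
  a subsequence converging in \<open>Y\<close>. The norms need only be seminorms on the representing
  functions, whence the use of norms of differences instead of a topology on a quotient.\<close>

definition compact_embedding ::
    "'v::minus set \<Rightarrow> ('v \<Rightarrow> real) \<Rightarrow> 'v set \<Rightarrow> ('v \<Rightarrow> real) \<Rightarrow> bool" where
  "compact_embedding X nX Y nY \<longleftrightarrow>
     X \<subseteq> Y \<and>
     (\<forall>u :: nat \<Rightarrow> 'v. (\<forall>n. u n \<in> X) \<and> (\<exists>C. \<forall>n. nX (u n) \<le> C) \<longrightarrow>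
        (\<exists>r v. strict_mono (r :: nat \<Rightarrow> nat) \<and> v \<in> Y \<and>
           (\<lambda>n. nY (u (r n) - v)) \<longlonglongrightarrow> 0))"

end

theory Submission
  imports Defs "HOL-Probability.Characteristic_Functions" "HOL-Complex_Analysis.Great_Picard"
begin

text \<open>
  By Plancherel, \<open>(2\<pi>)\<^sup>d \<integral> B[u,u] = \<integral> m |\<F>u|\<^sup>2\<close>. If \<open>m\<close> tends to infinity, then a bound on the energy
  makes the high-frequency part of the \<open>L\<^sup>2\<close> norm uniformly small, while on bounded frequency
  regions the transforms of functions supported in \<open>\<Omega>\<close> are uniformly bounded and uniformly
  Lipschitz, so that a subsequence of them converges; together this gives a Cauchy sequence in
  \<open>L\<^sup>2\<close>. If conversely \<open>m(\<xi>\<^sub>n)\<close> stays bounded along some \<open>\<xi>\<^sub>n \<rightarrow> \<infinity>\<close>, then for a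
  Lipschitz bump \<open>\<phi>\<close> in \<open>\<Omega>\<close> the functions \<open>\<phi>(x) cos(\<xi>\<^sub>n \<bullet> x)\<close> have bounded energy, but by the
  Riemann--Lebesgue lemma their mutual \<open>L\<^sup>2\<close> distances do not tend to zero.

  Plancherel is obtained by testing with Gaussian weights: \<open>\<integral> |\<F>u|\<^sup>2 exp(- |s\<xi>|\<^sup>2 / 2)\<close> is a Gaussian average
  of the autocorrelation of \<open>u\<close> at scale \<open>s\<close>, which is continuous at the origin.
\<close>

subsection \<open>Square-integrable functions\<close>

text \<open>Two obstacles shape the proof. Expanding \<open>|F u|^2\<close> as a double integral
  over \<open>x\<close>, \<open>y\<close> and integrating the frequency first is not absolutely
  convergent. A Gaussian weight makes Fubini legitimate, and since its transform is again Gaussian,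
  the inner integral is explicit. The weight is removed by monotone convergence, so square
  integrability of the transform is a conclusion and not an assumption. Energies live in
  [0,\<infinity>], so Tonelli suffices and the energy identity also covers infinite energy.

  In the converse, \<open>\<mu>\<close> may have infinite mass near the origin and a modulated bump
  has gradient of order |\<xi>|, so estimating its increments by a Lipschitz constant would lose the
  bound. The product rule isolates the increment of the cosine, whose square is at most
  \<open>2 * (1 - cos (\<xi> \<bullet> z))\<close> and thus integrates to the multiplier itself,
  while increments of the bump cost only \<open>min ((norm z)\<^sup>2) 1\<close>.\<close>

lemma nn_integral_lborel_shift:
  fixes f :: "'a::euclidean_space \<Rightarrow> ennreal"
  assumes "f \<in> borel_measurable borel"
  shows "(\<integral>\<^sup>+x. f (x + h) \<partial>lborel) = (\<integral>\<^sup>+x. f x \<partial>lborel)"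
  using assms lborel_distr_plus[of h] nn_integral_distr[of "(+) h" lborel borel f]
  by (simp add: add.commute)

lemma integral_lborel_shift:
  fixes f :: "'a::euclidean_space \<Rightarrow> 'b::{banach, second_countable_topology}"
  assumes "f \<in> borel_measurable borel"
  shows "(LINT x|lborel. f (x + h)) = (LINT x|lborel. f x)"
  using assms lborel_distr_plus[of h] integral_distr[of "(+) h" lborel borel f]
  by (simp add: add.commute)

lemma integrable_lborel_shift:
  fixes f :: "'a::euclidean_space \<Rightarrow> 'b::{banach, second_countable_topology}"
  assumes "integrable lborel f"
  shows "integrable lborel (\<lambda>x. f (x + h))"
  using assms lborel_distr_plus[of h] integrable_distr[of "(+) h" lborel borel f]
  by (simp add: add.commute)

lemma integral_lborel_affine:
  fixes f :: "'a::euclidean_space \<Rightarrow> 'b::{banach, second_countable_topology}"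
  assumes "f \<in> borel_measurable borel" "c > 0"
  shows "(LINT x|lborel. f x) = (c ^ DIM('a)) *\<^sub>R (LINT x|lborel. f (t + c *\<^sub>R x))"
  using assms
  by (subst lborel_affine[of c t])
     (simp_all add: integral_density integral_distr ennreal_power)

lemma integrable_lborel_affine:
  fixes f :: "'a::euclidean_space \<Rightarrow> 'b::{banach, second_countable_topology}"
  assumes f: "integrable lborel f" and c: "c > 0"
  shows "integrable lborel (\<lambda>x. f (t + c *\<^sub>R x))"
proof -
  have [measurable]: "f \<in> borel_measurable borel"
    using f by (auto dest: borel_measurable_integrable)
  have "integrable (density (distr lborel borel (\<lambda>x. t + c *\<^sub>R x)) (\<lambda>_. ennreal (c ^ DIM('a)))) f"
    using f lborel_affine[of c t] c by (simp add: ennreal_power)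
  then have "integrable lborel (\<lambda>x. c ^ DIM('a) *\<^sub>R f (t + c *\<^sub>R x))"
    using c by (simp add: integrable_density integrable_distr_eq)
  then have "integrable lborel (\<lambda>x. inverse (c ^ DIM('a)) *\<^sub>R c ^ DIM('a) *\<^sub>R f (t + c *\<^sub>R x))"
    by (rule integrable_scaleR_right)
  then show ?thesis using c by simp
qed

lemma integrable_indicator_cball:
  "integrable lborel (\<lambda>x::'a::euclidean_space. (c::real) * indicator (cball a r) x)"
  using emeasure_lborel_cball_finite[of a r]
  by (intro integrable_mult_right) (auto simp: less_top[symmetric])

section \<open>Sums, translates and integrability of square-integrable functions\<close>

lemma L2_nn_shift:
  assumes [measurable]: "u \<in> borel_measurable borel"
  shows "L2_nn (\<lambda>x. u (x + h)) = L2_nn u"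
  unfolding L2_nn_def by (rule nn_integral_lborel_shift[of "\<lambda>x. ennreal ((u x)\<^sup>2)"]) simp

lemma square_sum_le: "(a + b)\<^sup>2 \<le> 2 * a\<^sup>2 + 2 * (b::real)\<^sup>2"
  using sum_squares_ge_zero[of "a - b" 0] by (simp add: power2_eq_square algebra_simps)

lemma L2_nn_add_le:
  assumes [measurable]: "u \<in> borel_measurable borel" "v \<in> borel_measurable borel"
  shows "L2_nn (\<lambda>x. u x + v x) \<le> 2 * L2_nn u + 2 * L2_nn v"
proof -
  have "L2_nn (\<lambda>x. u x + v x)
      \<le> (\<integral>\<^sup>+x. 2 * ennreal ((u x)\<^sup>2) + 2 * ennreal ((v x)\<^sup>2) \<partial>lborel)"
    unfolding L2_nn_def
  proof (rule nn_integral_mono)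
    fix x :: 'a
    have "ennreal ((u x + v x)\<^sup>2) \<le> ennreal (2 * (u x)\<^sup>2 + 2 * (v x)\<^sup>2)"
      by (intro ennreal_leI square_sum_le)
    then show "ennreal ((u x + v x)\<^sup>2) \<le> 2 * ennreal ((u x)\<^sup>2) + 2 * ennreal ((v x)\<^sup>2)"
      by (simp add: ennreal_plus ennreal_mult)
  qed
  also have "\<dots> = 2 * L2_nn u + 2 * L2_nn v"
    unfolding L2_nn_def by (simp add: nn_integral_add nn_integral_cmult)
  finally show ?thesis .
qed

lemma L2_nn_uminus: "L2_nn (\<lambda>x. - u x) = L2_nn u"
  by (simp add: L2_nn_def)

lemma L2_nn_diff_le:
  assumes [measurable]: "u \<in> borel_measurable borel" "v \<in> borel_measurable borel"
  shows "L2_nn (\<lambda>x. u x - v x) \<le> 2 * L2_nn u + 2 * L2_nn v"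
  using L2_nn_add_le[of u "\<lambda>x. - v x"] by (simp add: L2_nn_uminus)

lemma L2_diff:
  assumes "u \<in> L2 S" "v \<in> L2 S"
  shows "(\<lambda>x. u x - v x) \<in> L2 S"
proof -
  from assms have [measurable]: "u \<in> borel_measurable borel" "v \<in> borel_measurable borel"
    by (auto simp: L2_def)
  have "L2_nn u < \<infinity>" "L2_nn v < \<infinity>" using assms by (auto simp: L2_def)
  then have "2 * L2_nn u + 2 * L2_nn v < \<infinity>"
    by (simp add: ennreal_mult_less_top)
  with L2_nn_diff_le[of u v] have "L2_nn (\<lambda>x. u x - v x) < \<infinity>"
    by (simp add: order_le_less_trans)
  moreover have "AE x in lborel. x \<notin> S \<longrightarrow> u x - v x = 0"
  proof -
    have "AE x in lborel. x \<notin> S \<longrightarrow> u x = 0" "AE x in lborel. x \<notin> S \<longrightarrow> v x = 0"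
      using assms by (auto simp: L2_def)
    then show ?thesis by eventually_elim auto
  qed
  ultimately show ?thesis by (simp add: L2_def)
qed

lemma L2_mono: "u \<in> L2 S \<Longrightarrow> S \<subseteq> T \<Longrightarrow> u \<in> L2 T"
  unfolding L2_def by (auto elim!: eventually_mono)

lemma AE_lborel_shift:
  fixes P :: "'a::euclidean_space \<Rightarrow> bool"
  assumes "AE x in lborel. P x"
  shows "AE x in lborel. P (x + h)"
proof -
  have "AE x in distr lborel borel ((+) h). P x"
    unfolding lborel_distr_plus by (rule assms)
  then have "AE x in lborel. P (h + x)"
    by (rule AE_distrD[rotated]) simp
  then show ?thesis by (simp add: add.commute)
qed

lemma L2_shift:
  assumes "u \<in> L2 (cball 0 R)" "norm h \<le> r"
  shows "(\<lambda>x. u (x + h)) \<in> L2 (cball 0 (R + r))"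
proof -
  from assms have [measurable]: "u \<in> borel_measurable borel" by (auto simp: L2_def)
  have "AE x in lborel. x \<notin> cball 0 R \<longrightarrow> u x = 0" using assms by (auto simp: L2_def)
  then have "AE x in lborel. x + h \<notin> cball 0 R \<longrightarrow> u (x + h) = 0"
    by (rule AE_lborel_shift)
  then have "AE x in lborel. x \<notin> cball 0 (R + r) \<longrightarrow> u (x + h) = 0"
  proof eventually_elim
    case (elim x)
    moreover have "norm x \<le> norm (x + h) + norm h" by norm
    ultimately show ?case using assms(2) by auto
  qed
  then show ?thesis using assms L2_nn_shift[of u h] by (auto simp: L2_def)
qed

text \<open>Rests on |t| \<le> 1 + t^2. For bounded support this replaces Cauchy-Schwarz, both for
  the integrability of \<open>u\<close> and for the uniform L1 bound behind the compactness
  argument.\<close>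

lemma L2_AE_abs_le:
  assumes u: "u \<in> L2 S" and S: "S \<subseteq> T"
  shows "AE x in lborel. \<bar>u x\<bar> \<le> indicator T x + (u x)\<^sup>2"
proof -
  have "AE x in lborel. x \<notin> S \<longrightarrow> u x = 0" using u by (auto simp: L2_def)
  then show ?thesis
  proof eventually_elim
    case (elim x)
    have "\<bar>u x\<bar> \<le> 1 + (u x)\<^sup>2"
      using self_le_power[of "\<bar>u x\<bar>" 2] by (cases "\<bar>u x\<bar> \<le> 1") (auto intro: add_increasing2)
    then show ?case using elim S by (auto simp: indicator_def)
  qed
qed

lemma L2_integrable:
  assumes "u \<in> L2 S" "bounded S"
  shows "integrable lborel u" "integrable lborel (\<lambda>x. (u x)\<^sup>2)"
proof -
  from assms have [measurable]: "u \<in> borel_measurable borel" by (auto simp: L2_def)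
  obtain R where R: "S \<subseteq> cball 0 R" using bounded_subset_ballD[OF assms(2), of 0] ball_subset_cball by (metis subset_trans)
  show sq: "integrable lborel (\<lambda>x. (u x)\<^sup>2)"
    using assms by (intro integrableI_bounded) (auto simp: L2_def L2_nn_def)
  have "integrable lborel (\<lambda>x. indicator (cball 0 R) x + (u x)\<^sup>2)"
    using integrable_indicator_cball[of 1 0 R]
    by (intro Bochner_Integration.integrable_add sq) simp
  then show "integrable lborel u"
  proof (rule Bochner_Integration.integrable_bound)
    show "AE x in lborel. norm (u x) \<le> norm (indicator (cball 0 R) x + (u x)\<^sup>2)"
      using L2_AE_abs_le[OF assms(1) R] by eventually_elim auto
  qed simp
qed

lemma L2_nn_eq_integral:
  assumes "u \<in> L2 S" "bounded S"
  shows "L2_nn u = ennreal (LINT x|lborel. (u x)\<^sup>2)"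
  unfolding L2_nn_def by (rule nn_integral_eq_integral) (auto intro: L2_integrable assms)

section \<open>Approximation by continuous functions and continuity of translations\<close>

lemma tendsto_clamp:
  fixes a :: real
  shows "(\<lambda>n. max (- real n) (min (real n) a)) \<longlonglongrightarrow> a"
proof (rule tendsto_eventually)
  obtain N where "\<bar>a\<bar> \<le> real N" using real_arch_simple by blast
  then show "\<forall>\<^sub>F n in sequentially. max (- real n) (min (real n) a) = a"
    by (intro eventually_sequentiallyI[of N]) (auto simp: max_def min_def)
qed

text \<open>Dominated convergence with a majorant for the squared differences; it serves truncation,
  continuous approximation and translation alike.\<close>

lemma L2_nn_diff_tendsto_0:
  fixes u :: "'a::euclidean_space \<Rightarrow> real"
  assumes [measurable]: "u \<in> borel_measurable borel" "\<And>n. v n \<in> borel_measurable borel"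
    and w: "integrable lborel w" and le: "\<And>n. AE x in lborel. (u x - v n x)\<^sup>2 \<le> w x"
    and lim: "AE x in lborel. (\<lambda>n. v n x) \<longlonglongrightarrow> u x"
  shows "(\<lambda>n. L2_nn (\<lambda>x. u x - v n x)) \<longlonglongrightarrow> 0"
proof -
  have [measurable]: "w \<in> borel_measurable borel" using w by (auto dest: borel_measurable_integrable)
  have "(\<lambda>n. \<integral>\<^sup>+x. ennreal ((u x - v n x)\<^sup>2) \<partial>lborel) \<longlonglongrightarrow> (\<integral>\<^sup>+x. (0::ennreal) \<partial>(lborel::'a measure))"
  proof (rule nn_integral_dominated_convergence[where w = "\<lambda>x. ennreal (norm (w x))"])
    show "(\<integral>\<^sup>+ x. ennreal (norm (w x)) \<partial>lborel) < \<infinity>"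
      using w by (simp add: integrable_iff_bounded)
    show "AE x in lborel. ennreal ((u x - v n x)\<^sup>2) \<le> ennreal (norm (w x))" for n
      using le[of n] by eventually_elim (auto intro!: ennreal_leI)
    show "AE x in lborel. (\<lambda>n. ennreal ((u x - v n x)\<^sup>2)) \<longlonglongrightarrow> 0"
      using lim
    proof eventually_elim
      case (elim x)
      have "(\<lambda>n. (u x - v n x)\<^sup>2) \<longlonglongrightarrow> (u x - u x)\<^sup>2"
        by (intro tendsto_intros elim)
      then show ?case using tendsto_ennrealI by fastforce
    qed
  qed simp_all
  then show ?thesis by (simp add: L2_nn_def)
qed

lemma clamp_diff_sq_le:
  assumes "c \<ge> 0"
  shows "(a - max (- c) (min c a))\<^sup>2 \<le> (a::real)\<^sup>2"
  by (rule abs_le_square_iff[THEN iffD1]) (use assms in \<open>auto simp: max_def min_def\<close>)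

text \<open>Truncation comes first: a measurable function is an almost everywhere limit of
  continuous ones, but without domination. Only for a bounded limit with bounded support can the
  approximants be clamped and cut off so as to share an integrable majorant.\<close>

lemma L2_approx_continuous:
  fixes u :: "'a::euclidean_space \<Rightarrow> real"
  assumes u: "u \<in> L2 (cball 0 R)" and e: "e > 0"
  obtains v where "continuous_on UNIV v" "\<And>x. norm x \<ge> R + 1 \<Longrightarrow> v x = 0"
    "L2_nn (\<lambda>x. u x - v x) < ennreal e"
proof -
  from u have [measurable]: "u \<in> borel_measurable borel"
    and AE0: "AE x in lborel. x \<notin> cball 0 R \<longrightarrow> u x = 0" by (auto simp: L2_def)
  \<comment> \<open>A quarter each, because \<open>L2_nn_add_le\<close> doubles both errors.\<close>
  have e': "ennreal (e / 4) > 0" using e by simp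
  define c where "c n x = max (- real n) (min (real n) (u x))" for n x
  have [measurable]: "c n \<in> borel_measurable borel" for n unfolding c_def by measurable
  have "(\<lambda>n. L2_nn (\<lambda>x. u x - c n x)) \<longlonglongrightarrow> 0"
  proof (rule L2_nn_diff_tendsto_0)
    show "integrable lborel (\<lambda>x. (u x)\<^sup>2)" by (rule L2_integrable[OF u]) simp
  qed (auto simp: c_def intro!: clamp_diff_sq_le tendsto_clamp)
  from order_tendstoD(2)[OF this e'] obtain n where n: "L2_nn (\<lambda>x. u x - c n x) < ennreal (e / 4)"
    by (auto dest: eventually_happens)
  have "(c n) measurable_on UNIV"
    by (rule lebesgue_measurable_imp_measurable_on)
       (simp_all add: measurable_completion)
  then obtain N g where N: "negligible N" and g: "\<And>k. continuous_on UNIV (g k)"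
    and lim: "\<And>x. x \<notin> N \<Longrightarrow> (\<lambda>k. g k x) \<longlonglongrightarrow> c n x"
    unfolding measurable_on_def by auto
  \<comment> \<open>Clamping at level \<open>n\<close> and the cutoff, which is 1 on the ball of
    radius \<open>R\<close> and 0 beyond radius \<open>R + 1\<close>, do not change the limit
    \<open>c n\<close> almost everywhere, but they make the family uniformly bounded with a common
    support.\<close>
  define v where "v k x = max (- real n) (min (real n) (g k x)) * max 0 (min 1 (R + 1 - norm x))" for k x
  have cont: "continuous_on UNIV (v k)" for k unfolding v_def by (intro continuous_intros g)
  have [measurable]: "v k \<in> borel_measurable borel" for k
    by (rule borel_measurable_continuous_onI[OF cont])
  have "AE x in lebesgue. x \<notin> N"
    using N unfolding negligible_iff_null_sets by (rule AE_not_in)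
  then have AEN: "AE x in lborel. x \<notin> N" by (simp add: AE_completion_iff)
  have "(\<lambda>k. L2_nn (\<lambda>x. c n x - v k x)) \<longlonglongrightarrow> 0"
  proof (rule L2_nn_diff_tendsto_0)
    show "integrable lborel (\<lambda>x::'a. (2 * real n)\<^sup>2 * indicator (cball 0 (R + 1)) x)"
      by (rule integrable_indicator_cball)
    show "AE x in lborel. (c n x - v k x)\<^sup>2 \<le> (2 * real n)\<^sup>2 * indicator (cball 0 (R + 1)) x" for k
      using AE0
    proof eventually_elim
      case (elim x)
      have "\<bar>v k x\<bar> \<le> real n * 1"
        unfolding v_def abs_mult by (intro mult_mono) auto
      moreover have "\<bar>c n x\<bar> \<le> real n" unfolding c_def by auto
      ultimately have "\<bar>c n x - v k x\<bar> \<le> \<bar>2 * real n\<bar>" by linarith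
      then have "(c n x - v k x)\<^sup>2 \<le> (2 * real n)\<^sup>2" by (rule abs_le_square_iff[THEN iffD1])
      moreover have "c n x = 0 \<and> v k x = 0" if "norm x > R + 1"
        using that elim by (auto simp: c_def v_def)
      ultimately show ?case by (auto simp: indicator_def)
    qed
    show "AE x in lborel. (\<lambda>k. v k x) \<longlonglongrightarrow> c n x"
      using AE0 AEN
    proof eventually_elim
      case (elim x)
      have "(\<lambda>k. v k x) \<longlonglongrightarrow> max (- real n) (min (real n) (c n x)) * max 0 (min 1 (R + 1 - norm x))"
        unfolding v_def by (intro tendsto_intros lim elim)
      also have "max (- real n) (min (real n) (c n x)) * max 0 (min 1 (R + 1 - norm x)) = c n x"
        using elim by (cases "norm x \<le> R") (auto simp: c_def)
      finally show ?case .
    qed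
  qed auto
  from order_tendstoD(2)[OF this e'] obtain k where k: "L2_nn (\<lambda>x. c n x - v k x) < ennreal (e / 4)"
    by (auto dest: eventually_happens)
  have "L2_nn (\<lambda>x. u x - v k x) = L2_nn (\<lambda>x. (u x - c n x) + (c n x - v k x))" by simp
  also have "\<dots> \<le> 2 * L2_nn (\<lambda>x. u x - c n x) + 2 * L2_nn (\<lambda>x. c n x - v k x)"
    by (rule L2_nn_add_le) auto
  also have "\<dots> < 2 * ennreal (e / 4) + 2 * ennreal (e / 4)"
    using n k by (intro add_strict_mono ennreal_mult_strict_left_mono) auto
  also have "\<dots> = ennreal e"
    using e by (simp add: ennreal_plus[symmetric] ennreal_mult[symmetric] del: ennreal_plus flip: ennreal_numeral)
  finally show thesis
    using cont[of k] by (intro that[of "v k"]) (auto simp: v_def)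
qed

text \<open>For a continuous \<open>v\<close> of bounded support this is dominated convergence. The
  error \<open>u - v\<close> has the same norm before and after the shift, so approximation carries
  the claim over to \<open>u\<close>.\<close>

lemma L2_translation_continuous:
  fixes u :: "'a::euclidean_space \<Rightarrow> real"
  assumes u: "u \<in> L2 (cball 0 R)" and h: "h \<longlonglongrightarrow> 0"
  shows "(\<lambda>n. L2_nn (\<lambda>x. u (x + h n) - u x)) \<longlonglongrightarrow> 0"
proof (rule order_tendstoI)
  fix e :: ennreal assume "e > 0"
  then obtain y where y: "0 < y" "y < e" using dense by blast
  then obtain r where r: "r > 0" "ennreal r < e" by (cases y) auto
  \<comment> \<open>The nested doubling inequalities below cost 2d + 2(2d + 2d) = 10d, which is less
    than \<open>r\<close>.\<close>
  define d where "d = r / 16"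
  have d: "d > 0" using r by (simp add: d_def)
  obtain v where v: "continuous_on UNIV v" and v0: "\<And>x. norm x \<ge> R + 1 \<Longrightarrow> v x = 0"
    and uv: "L2_nn (\<lambda>x. u x - v x) < ennreal d"
    using L2_approx_continuous[OF u, of d] d by auto
  from u have [measurable]: "u \<in> borel_measurable borel" by (auto simp: L2_def)
  have [measurable]: "v \<in> borel_measurable borel" by (rule borel_measurable_continuous_onI[OF v])
  have "bounded (v ` cball 0 (R + 1))"
    by (intro compact_imp_bounded compact_continuous_image continuous_on_subset[OF v]) auto
  then obtain B where B: "\<forall>x\<in>cball 0 (R + 1). \<bar>v x\<bar> \<le> B" "B > 0"
    unfolding bounded_pos by auto
  have B': "\<bar>v x\<bar> \<le> B" for x
    using B v0[of x] by (cases "norm x \<le> R + 1") auto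
  \<comment> \<open>Convergent shifts are bounded, so all shifted copies of \<open>v\<close> are
    supported in one ball.\<close>
  obtain H where H: "\<And>n. norm (h n) \<le> H"
    using h convergent_imp_Bseq[of h] by (auto simp: convergent_def Bseq_def)
  have "(\<lambda>n. L2_nn (\<lambda>x. v x - v (x + h n))) \<longlonglongrightarrow> 0"
  proof (rule L2_nn_diff_tendsto_0)
    show "integrable lborel (\<lambda>x::'a. (2 * B)\<^sup>2 * indicator (cball 0 (R + 1 + H)) x)"
      by (rule integrable_indicator_cball)
    show "AE x in lborel. (v x - v (x + h n))\<^sup>2 \<le> (2 * B)\<^sup>2 * indicator (cball 0 (R + 1 + H)) x" for n
    proof (rule AE_I2)
      fix x
      have "\<bar>v x - v (x + h n)\<bar> \<le> \<bar>2 * B\<bar>" using B'[of x] B'[of "x + h n"] by linarith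
      then have "(v x - v (x + h n))\<^sup>2 \<le> (2 * B)\<^sup>2" by (rule abs_le_square_iff[THEN iffD1])
      moreover have "v x = 0 \<and> v (x + h n) = 0" if "norm x > R + 1 + H"
      proof -
        have "norm x \<le> norm (x + h n) + norm (h n)" by norm
        then have "norm (x + h n) \<ge> R + 1" using that H[of n] by linarith
        moreover have "norm x \<ge> R + 1" using that H[of n] norm_ge_zero[of "h n"] by linarith
        ultimately show ?thesis by (intro conjI v0)
      qed
      ultimately show "(v x - v (x + h n))\<^sup>2 \<le> (2 * B)\<^sup>2 * indicator (cball 0 (R + 1 + H)) x"
        by (auto simp: indicator_def)
    qed
    show "AE x in lborel. (\<lambda>n. v (x + h n)) \<longlonglongrightarrow> v x"
    proof (rule AE_I2)
      fix x
      have "(\<lambda>n. x + h n) \<longlonglongrightarrow> x" using tendsto_add[OF tendsto_const h] by simp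
      then show "(\<lambda>n. v (x + h n)) \<longlonglongrightarrow> v x"
        by (rule continuous_on_tendsto_compose[OF v]) auto
    qed
  qed auto
  from order_tendstoD(2)[OF this, of "ennreal d"] d
  have "\<forall>\<^sub>F n in sequentially. L2_nn (\<lambda>x. v x - v (x + h n)) < ennreal d" by simp
  then show "\<forall>\<^sub>F n in sequentially. L2_nn (\<lambda>x. u (x + h n) - u x) < e"
  proof eventually_elim
    case (elim n)
    have "L2_nn (\<lambda>x. u (x + h n) - u x)
        = L2_nn (\<lambda>x. (u (x + h n) - v (x + h n)) - ((u x - v x) + (v x - v (x + h n))))"
      by simp
    also have "\<dots> \<le> 2 * L2_nn (\<lambda>x. u (x + h n) - v (x + h n)) + 2 * L2_nn (\<lambda>x. (u x - v x) + (v x - v (x + h n)))"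
      by (rule L2_nn_diff_le) auto
    also have "\<dots> \<le> 2 * L2_nn (\<lambda>x. u x - v x) + 2 * (2 * L2_nn (\<lambda>x. u x - v x) + 2 * L2_nn (\<lambda>x. v x - v (x + h n)))"
      using L2_nn_shift[of "\<lambda>x. u x - v x" "h n"]
      by (intro add_mono mult_left_mono L2_nn_add_le) auto
    also have "\<dots> \<le> 2 * ennreal d + 2 * (2 * ennreal d + 2 * ennreal d)"
      using uv elim by (intro add_mono mult_left_mono) auto
    also have "\<dots> = ennreal (10 * d)"
      using d by (simp add: ennreal_plus[symmetric] ennreal_mult[symmetric] del: ennreal_plus flip: ennreal_numeral)
    also have "\<dots> \<le> ennreal r" using r by (intro ennreal_leI) (auto simp: d_def)
    finally show ?case using r(2) by (rule order_le_less_trans)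
  qed
qed simp

section \<open>Completeness of L2\<close>

lemma L2_norm_tendsto_0_iff:
  assumes "\<And>n. L2_nn (u n) < \<infinity>"
  shows "(\<lambda>n. L2_norm (u n)) \<longlonglongrightarrow> 0 \<longleftrightarrow> (\<lambda>n. L2_nn (u n)) \<longlonglongrightarrow> 0"
proof -
  \<comment> \<open>Finiteness matters here: \<open>enn2real\<close> sends infinity to 0.\<close>
  have "L2_nn (u n) = ennreal ((L2_norm (u n))\<^sup>2)" for n
    using assms[of n] by (simp add: L2_norm_def)
  then have "(\<lambda>n. L2_nn (u n)) \<longlonglongrightarrow> 0 \<longleftrightarrow> (\<lambda>n. (L2_norm (u n))\<^sup>2) \<longlonglongrightarrow> 0"
    by (simp add: ennreal_tendsto_0_iff)
  also have "\<dots> \<longleftrightarrow> (\<lambda>n. L2_norm (u n)) \<longlonglongrightarrow> 0"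
  proof
    assume "(\<lambda>n. (L2_norm (u n))\<^sup>2) \<longlonglongrightarrow> 0"
    from tendsto_real_sqrt[OF this] show "(\<lambda>n. L2_norm (u n)) \<longlonglongrightarrow> 0"
      by (simp add: L2_norm_def)
  next
    assume "(\<lambda>n. L2_norm (u n)) \<longlonglongrightarrow> 0"
    from tendsto_power[OF this, of 2] show "(\<lambda>n. (L2_norm (u n))\<^sup>2) \<longlonglongrightarrow> 0"
      by simp
  qed
  finally show ?thesis by simp
qed

text \<open>If |a| exceeds 2^-k, then 1 \<le> 2^k |a|, and multiplying by |a| gives the second term.
  This converts summability of weighted squares into absolute summability.\<close>

lemma abs_le_geometric_plus_square:
  "\<bar>a::real\<bar> \<le> (1/2) ^ k + 2 ^ k * a\<^sup>2"
proof (cases "\<bar>a\<bar> \<le> (1/2) ^ k")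
  case False
  then have "1 \<le> 2 ^ k * \<bar>a\<bar>" by (simp add: field_simps)
  then have "1 * \<bar>a\<bar> \<le> 2 ^ k * \<bar>a\<bar> * \<bar>a\<bar>" by (intro mult_right_mono) auto
  then have "\<bar>a\<bar> \<le> 2 ^ k * a\<^sup>2" by (simp add: power2_eq_square)
  then show ?thesis by (simp add: add_increasing)
qed (simp add: add_increasing2)

text \<open>The thresholds need not be monotone; the partial sums of their successors increase
  strictly and dominate each of them.\<close>

lemma rapid_subsequence:
  fixes P :: "nat \<Rightarrow> nat \<Rightarrow> bool"
  assumes "\<And>k. \<exists>N. \<forall>n\<ge>N. P k n"
  shows "\<exists>r :: nat \<Rightarrow> nat. strict_mono r \<and> (\<forall>k. \<forall>n\<ge>r k. P k n)"
proof -
  obtain N where N: "\<And>k n. n \<ge> N k \<Longrightarrow> P k n" using assms by metis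
  let ?r = "\<lambda>k. \<Sum>i\<le>k. Suc (N i)"
  have "strict_mono ?r" by (rule strict_monoI_Suc) simp
  moreover have "?r k \<ge> N k" for k
    by (rule order_trans[OF _ member_le_sum[of k]]) auto
  ultimately show ?thesis using N by (intro exI[of _ ?r]) (meson order_trans)
qed

text \<open>Riesz-Fischer. Along a rapid subsequence the weighted squared increments have a finite
  integral, so the increments are absolutely summable almost everywhere; Fatou then transfers
  convergence from the subsequence to the whole sequence.\<close>

lemma L2_complete:
  fixes u :: "nat \<Rightarrow> 'a::euclidean_space \<Rightarrow> real"
  assumes u: "\<And>n. u n \<in> L2 S"
    and Cauchy: "\<And>e. e > 0 \<Longrightarrow> \<exists>N. \<forall>n\<ge>N. \<forall>m\<ge>N. L2_nn (\<lambda>x. u n x - u m x) < ennreal e"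
  obtains v where "v \<in> L2 S" "(\<lambda>n. L2_nn (\<lambda>x. u n x - v x)) \<longlonglongrightarrow> 0"
proof -
  have [measurable]: "u n \<in> borel_measurable borel" for n using u[of n] by (auto simp: L2_def)
  have "\<exists>N. \<forall>n\<ge>N. \<forall>m\<ge>n. L2_nn (\<lambda>x. u n x - u m x) < ennreal ((1/4) ^ k)" for k
  proof -
    obtain N where "\<forall>n\<ge>N. \<forall>m\<ge>N. L2_nn (\<lambda>x. u n x - u m x) < ennreal ((1/4) ^ k)"
      using Cauchy[of "(1/4) ^ k"] by auto
    then show ?thesis by (intro exI[of _ N]) auto
  qed
  then have "\<exists>r. strict_mono r \<and> (\<forall>k. \<forall>n\<ge>r k. \<forall>m\<ge>n. L2_nn (\<lambda>x. u n x - u m x) < ennreal ((1/4) ^ k))"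
    by (rule rapid_subsequence)
  then obtain r where r: "strict_mono r"
    and rapid: "\<forall>k. \<forall>n\<ge>r k. \<forall>m\<ge>n. L2_nn (\<lambda>x. u n x - u m x) < ennreal ((1/4) ^ k)"
    by (elim exE conjE)
  define d where "d k x = u (r k) x - u (r (Suc k)) x" for k x
  have [measurable]: "d k \<in> borel_measurable borel" for k unfolding d_def by measurable
  have d: "L2_nn (d k) \<le> ennreal ((1/4) ^ k)" for k
  proof -
    have "r (Suc k) \<ge> r k" using strict_mono_mono[OF r] by (simp add: monoD)
    then show ?thesis using rapid unfolding d_def[abs_def] by (auto intro: less_imp_le)
  qed
  \<comment> \<open>The squared norms of the increments are at most 4^-k, so the weights 2^k still
    leave a geometric series of ratio 1/2.\<close>
  have "(\<integral>\<^sup>+x. (\<Sum>k. ennreal (2 ^ k * (d k x)\<^sup>2)) \<partial>lborel) = (\<Sum>k. \<integral>\<^sup>+x. ennreal (2 ^ k * (d k x)\<^sup>2) \<partial>lborel)"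
    by (rule nn_integral_suminf) measurable
  also have "\<dots> = (\<Sum>k. ennreal (2 ^ k) * L2_nn (d k))"
    by (simp add: L2_nn_def ennreal_mult nn_integral_cmult)
  also have "\<dots> \<le> (\<Sum>k. ennreal ((1/2) ^ k))"
  proof (rule suminf_le)
    fix k
    have "ennreal (2 ^ k) * L2_nn (d k) \<le> ennreal (2 ^ k) * ennreal ((1/4) ^ k)"
      by (intro mult_left_mono d) simp
    also have "\<dots> = ennreal ((1/2) ^ k)"
      by (simp add: ennreal_mult[symmetric] power_mult_distrib[symmetric])
    finally show "ennreal (2 ^ k) * L2_nn (d k) \<le> ennreal ((1/2) ^ k)" .
  qed auto
  also have "\<dots> < \<infinity>"
  proof -
    have "(\<Sum>k. ennreal ((1/2) ^ k)) = ennreal (\<Sum>k. (1/2) ^ k)"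
      by (rule suminf_ennreal2) (auto intro: summable_geometric)
    then show ?thesis by simp
  qed
  finally have "AE x in lborel. (\<Sum>k. ennreal (2 ^ k * (d k x)\<^sup>2)) \<noteq> \<infinity>"
    by (intro nn_integral_noteq_infinite) auto
  then have conv: "AE x in lborel. convergent (\<lambda>k. u (r k) x)"
  proof eventually_elim
    case (elim x)
    have "summable (\<lambda>k. 2 ^ k * (d k x)\<^sup>2)"
      by (rule summable_suminf_not_top) (use elim in auto)
    then have "summable (\<lambda>k. (1/2) ^ k + 2 ^ k * (d k x)\<^sup>2)"
      by (intro summable_add summable_geometric) auto
    then have "summable (\<lambda>k. d k x)"
      by (rule summable_comparison_test'[where N = 0]) (auto intro: abs_le_geometric_plus_square)
    then have "convergent (\<lambda>n. \<Sum>k<n. d k x)" by (simp add: summable_iff_convergent)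
    also have "(\<lambda>n. \<Sum>k<n. d k x) = (\<lambda>n. u (r 0) x - u (r n) x)"
      unfolding d_def by (simp add: sum_lessThan_telescope'[of "\<lambda>k. u (r k) x"])
    finally have "convergent (\<lambda>n. u (r 0) x - (u (r 0) x - u (r n) x))"
      by (rule convergent_diff[OF convergent_const])
    then show ?case by (simp only: diff_diff_eq2 add_diff_cancel_left')
  qed
  \<comment> \<open>Where the subsequence diverges, \<open>lim\<close> has an unspecified value;
    these points form a null set, and \<open>v\<close> is measurable all the same.\<close>
  define v where "v x = lim (\<lambda>k. u (r k) x)" for x
  have [measurable]: "v \<in> borel_measurable borel"
    unfolding v_def[abs_def] by (rule borel_measurable_lim_metric) simp
  have lim: "AE x in lborel. (\<lambda>k. u (r k) x) \<longlonglongrightarrow> v x"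
    using conv unfolding v_def by eventually_elim (simp add: convergent_LIMSEQ_iff)
  have fatou: "L2_nn (\<lambda>x. u n x - v x) \<le> liminf (\<lambda>k. L2_nn (\<lambda>x. u n x - u (r k) x))" for n
  proof -
    have "L2_nn (\<lambda>x. u n x - v x) = (\<integral>\<^sup>+x. liminf (\<lambda>k. ennreal ((u n x - u (r k) x)\<^sup>2)) \<partial>lborel)"
      unfolding L2_nn_def
    proof (rule nn_integral_cong_AE)
      show "AE x in lborel. ennreal ((u n x - v x)\<^sup>2) = liminf (\<lambda>k. ennreal ((u n x - u (r k) x)\<^sup>2))"
        using lim
      proof eventually_elim
        case (elim x)
        then have "(\<lambda>k. ennreal ((u n x - u (r k) x)\<^sup>2)) \<longlonglongrightarrow> ennreal ((u n x - v x)\<^sup>2)"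
          by (intro tendsto_ennrealI tendsto_intros)
        then show ?case by (intro lim_imp_Liminf[symmetric]) auto
      qed
    qed
    also have "\<dots> \<le> liminf (\<lambda>k. L2_nn (\<lambda>x. u n x - u (r k) x))"
      unfolding L2_nn_def by (rule nn_integral_liminf) measurable
    finally show ?thesis .
  qed
  have small: "\<exists>N. \<forall>n\<ge>N. L2_nn (\<lambda>x. u n x - v x) \<le> ennreal e" if "e > 0" for e
  proof -
    obtain N where N: "\<And>n m. n \<ge> N \<Longrightarrow> m \<ge> N \<Longrightarrow> L2_nn (\<lambda>x. u n x - u m x) < ennreal e"
      using Cauchy[OF \<open>e > 0\<close>] by metis
    have "L2_nn (\<lambda>x. u n x - v x) \<le> ennreal e" if n: "n \<ge> N" for n
    proof -
      have "\<forall>\<^sub>F k in sequentially. L2_nn (\<lambda>x. u n x - u (r k) x) \<le> ennreal e"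
        using N[OF n] seq_suble[OF r]
        by (intro eventually_sequentiallyI[of N]) (meson less_imp_le order_trans)
      then have "liminf (\<lambda>k. L2_nn (\<lambda>x. u n x - u (r k) x)) \<le> liminf (\<lambda>k. ennreal e)"
        by (rule Liminf_mono)
      then show ?thesis using fatou[of n] by (simp add: Liminf_const)
    qed
    then show ?thesis by blast
  qed
  show thesis
  proof
    obtain N where N: "L2_nn (\<lambda>x. u N x - v x) \<le> ennreal 1" using small[of 1] by auto
    have "L2_nn v = L2_nn (\<lambda>x. u N x - (u N x - v x))" by simp
    also have "\<dots> \<le> 2 * L2_nn (u N) + 2 * L2_nn (\<lambda>x. u N x - v x)"
      by (rule L2_nn_diff_le) auto
    also have "\<dots> < \<infinity>"
    proof -
      have "L2_nn (u N) < \<infinity>" using u[of N] by (simp add: L2_def)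
      moreover have "L2_nn (\<lambda>x. u N x - v x) < \<infinity>" using N by (rule order_le_less_trans) simp
      ultimately show ?thesis by (simp add: ennreal_mult_less_top)
    qed
    finally have "L2_nn v < \<infinity>" .
    moreover have "AE x in lborel. x \<notin> S \<longrightarrow> v x = 0"
    proof -
      have "AE x in lborel. \<forall>n. x \<notin> S \<longrightarrow> u n x = 0"
        unfolding AE_all_countable using u by (auto simp: L2_def)
      then show ?thesis
        by eventually_elim (simp add: v_def)
    qed
    ultimately show "v \<in> L2 S" by (simp add: L2_def)
    show "(\<lambda>n. L2_nn (\<lambda>x. u n x - v x)) \<longlonglongrightarrow> 0"
    proof (rule order_tendstoI)
      fix e :: ennreal assume "e > 0"
      then obtain y where y: "0 < y" "y < e" using dense by blast
      then obtain s where s: "s > 0" "ennreal s < e" by (cases y) auto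
      then show "\<forall>\<^sub>F n in sequentially. L2_nn (\<lambda>x. u n x - v x) < e"
        using small[of s] unfolding eventually_sequentially by (meson order_le_less_trans)
    qed simp
  qed
qed

subsection \<open>Gaussians\<close>

text \<open>The standard normal density of the space, as a product over coordinates so that its
  integrals reduce to the one-dimensional density; \<open>gauss_eq\<close> is the radial
  form.\<close>

definition gauss :: "'a::euclidean_space \<Rightarrow> real" where
  "gauss x = (\<Prod>b\<in>Basis. std_normal_density (x \<bullet> b))"

lemma norm_sq_eq_sum_Basis:
  "(norm (x::'a::euclidean_space))\<^sup>2 = (\<Sum>b\<in>Basis. (x \<bullet> b)\<^sup>2)"
  unfolding power2_norm_eq_inner unfolding power2_eq_square by (rule euclidean_inner)

lemma gauss_eq:
  "gauss (x::'a::euclidean_space) = (1 / sqrt (2 * pi)) ^ DIM('a) * exp (- (norm x)\<^sup>2 / 2)"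
proof -
  have "(norm x)\<^sup>2 = (\<Sum>b\<in>Basis. (x \<bullet> b)\<^sup>2)"
    by (rule norm_sq_eq_sum_Basis)
  then have "- (norm x)\<^sup>2 / 2 = (\<Sum>b\<in>Basis. - (x \<bullet> b)\<^sup>2 / 2)"
    by (simp add: sum_negf sum_divide_distrib)
  then show ?thesis
    by (simp add: gauss_def std_normal_density_def prod.distrib exp_sum power_divide prod_dividef)
qed

lemma gauss_pos: "gauss x > 0"
  by (simp add: gauss_eq)

lemma gauss_le: "gauss (x::'a::euclidean_space) \<le> (1 / sqrt (2 * pi)) ^ DIM('a)"
  by (simp add: gauss_eq mult_left_le)

lemma borel_measurable_gauss [measurable]: "gauss \<in> borel_measurable borel"
  unfolding gauss_eq[abs_def] by measurable

lemma gauss_minus [simp]: "gauss (- x) = gauss x"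
  by (simp add: gauss_eq)

lemma integrable_gauss: "integrable lborel (gauss :: 'a::euclidean_space \<Rightarrow> real)"
proof (rule integrableI_bounded)
  have "(\<integral>\<^sup>+x. ennreal (norm (gauss (x::'a))) \<partial>lborel)
      = (\<integral>\<^sup>+x. (\<Prod>b\<in>Basis. ennreal (std_normal_density (x \<bullet> b))) \<partial>(lborel::'a measure))"
    by (intro nn_integral_cong) (simp add: gauss_def abs_prod prod_ennreal)
  also have "\<dots> = (\<Prod>b\<in>(Basis::'a set). \<integral>\<^sup>+x. ennreal (std_normal_density x) \<partial>lborel)"
    by (rule nn_integral_lborel_prod) auto
  also have "\<dots> < \<infinity>"
    by (simp add: nn_integral_eq_integral[OF integrable_normal_density])
  finally show "(\<integral>\<^sup>+x. ennreal (norm (gauss (x::'a))) \<partial>lborel) < \<infinity>" .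
qed simp

lemma std_normal_density_fourier:
  "(LINT x|lborel. std_normal_density x *\<^sub>R cis (t * x)) = complex_of_real (exp (- t\<^sup>2 / 2))"
proof -
  have "(LINT x|lborel. std_normal_density x *\<^sub>R cis (t * x)) = char std_normal_distribution t"
    unfolding char_def by (subst integral_density) (auto simp: cis_conv_exp)
  then show ?thesis by (simp add: char_std_normal_distribution)
qed

lemma cis_sum: "finite A \<Longrightarrow> cis (\<Sum>a\<in>A. f a) = (\<Prod>a\<in>A. cis (f a))"
  by (induction A rule: finite_induct) (auto simp flip: cis_mult)

text \<open>\<open>lborel\<close> is the image of the product of one-dimensional Lebesgue measures
  under the coordinate map.\<close>

lemma integral_lborel_prod:
  fixes f :: "'a::euclidean_space \<Rightarrow> real \<Rightarrow> complex"
  assumes "\<And>b. b \<in> Basis \<Longrightarrow> integrable lborel (f b)"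
  shows "(LINT x|lborel. (\<Prod>b\<in>Basis. f b (x \<bullet> b))) = (\<Prod>b\<in>Basis. LINT x|lborel. f b x)"
proof -
  interpret product_sigma_finite "\<lambda>b::'a. lborel :: real measure" ..
  have [measurable]: "f b \<in> borel_measurable borel" if "b \<in> Basis" for b
    using assms[OF that] by (auto dest: borel_measurable_integrable)
  have "(LINT x|lborel. (\<Prod>b\<in>Basis. f b (x \<bullet> b)))
      = (LINT x|(\<Pi>\<^sub>M b\<in>(Basis::'a set). lborel). (\<Prod>b\<in>Basis. f b ((\<Sum>b\<in>Basis. x b *\<^sub>R b) \<bullet> b)))"
    by (subst lborel_eq, subst integral_distr) auto
  also have "\<dots> = (LINT x|(\<Pi>\<^sub>M b\<in>(Basis::'a set). lborel). (\<Prod>b\<in>Basis. f b (x b)))"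
    by (intro Bochner_Integration.integral_cong refl prod.cong) auto
  also have "\<dots> = (\<Prod>b\<in>Basis. LINT x|lborel. f b x)"
    by (rule product_integral_prod) (auto simp: assms)
  finally show ?thesis .
qed

lemma gauss_fourier:
  fixes z :: "'a::euclidean_space"
  shows "(LINT x|lborel. gauss x *\<^sub>R cis (x \<bullet> z)) = complex_of_real (exp (- (norm z)\<^sup>2 / 2))"
proof -
  have "gauss x *\<^sub>R cis (x \<bullet> z)
      = (\<Prod>b\<in>Basis. std_normal_density (x \<bullet> b) *\<^sub>R cis ((z \<bullet> b) * (x \<bullet> b)))" for x :: 'a
    by (simp add: gauss_def euclidean_inner[of x z] cis_sum scaleR_conv_of_real prod.distrib mult.commute)
  then have "(LINT x|lborel. gauss x *\<^sub>R cis (x \<bullet> z))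
      = (LINT x|lborel. (\<Prod>b\<in>Basis. std_normal_density (x \<bullet> b) *\<^sub>R cis ((z \<bullet> b) * (x \<bullet> b))))"
    by (intro Bochner_Integration.integral_cong) auto
  also have "\<dots> = (\<Prod>b\<in>Basis. LINT x|lborel. std_normal_density x *\<^sub>R cis ((z \<bullet> b) * x))"
  proof (rule integral_lborel_prod)
    fix b :: 'a
    have "integrable lborel std_normal_density" by (rule integrable_normal_density) simp
    then show "integrable lborel (\<lambda>x. std_normal_density x *\<^sub>R cis ((z \<bullet> b) * x))"
      by (rule Bochner_Integration.integrable_bound) (auto simp: cis_conv_exp)
  qed
  also have "\<dots> = complex_of_real (exp (\<Sum>b\<in>Basis. - (z \<bullet> b)\<^sup>2 / 2))"
    by (simp add: std_normal_density_fourier exp_sum)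
  also have "(\<Sum>b\<in>Basis. - (z \<bullet> b)\<^sup>2 / 2) = - (norm z)\<^sup>2 / 2"
    by (simp add: norm_sq_eq_sum_Basis sum_negf sum_divide_distrib)
  finally show ?thesis .
qed

text \<open>The total mass is the Fourier transform at frequency zero.\<close>

lemma integral_gauss: "(LINT x|lborel. gauss (x::'a::euclidean_space)) = 1"
proof -
  have "complex_of_real (LINT x|lborel. gauss (x::'a)) = (LINT x|lborel. gauss x *\<^sub>R cis (x \<bullet> (0::'a)))"
    by (simp add: scaleR_conv_of_real)
  then show ?thesis by (subst (asm) gauss_fourier) simp
qed

text \<open>The Gaussian is its own transform up to normalisation. Writing the result through
  \<open>gauss\<close> again exhibits it as \<open>sqrt (2 * pi) ^ DIM('a)\<close> times an
  approximate identity of width \<open>s\<close>.\<close>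

lemma gauss_scaled_cos_integral:
  fixes z :: "'a::euclidean_space"
  assumes s: "s > 0"
  shows "(LINT x|lborel. cos (x \<bullet> z) * gauss (s *\<^sub>R x))
    = sqrt (2 * pi) ^ DIM('a) / s ^ DIM('a) * gauss (z /\<^sub>R s)"
proof -
  let ?F = "\<lambda>x. cos (x \<bullet> (z /\<^sub>R s)) * gauss x"
  have int: "integrable lborel (\<lambda>x. gauss x *\<^sub>R cis (x \<bullet> (z /\<^sub>R s)))"
    using integrable_gauss by (rule Bochner_Integration.integrable_bound) (auto simp: cis_conv_exp)
  have "(LINT x|lborel. ?F x) = (LINT x|lborel. Re (gauss x *\<^sub>R cis (x \<bullet> (z /\<^sub>R s))))"
    by (simp add: mult.commute)
  also have "\<dots> = exp (- (norm (z /\<^sub>R s))\<^sup>2 / 2)"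
    using integral_Re[OF int] gauss_fourier[of "z /\<^sub>R s"] by simp
  also have "\<dots> = sqrt (2 * pi) ^ DIM('a) * gauss (z /\<^sub>R s)"
    by (simp add: gauss_eq power_divide)
  finally have 1: "(LINT x|lborel. ?F x) = sqrt (2 * pi) ^ DIM('a) * gauss (z /\<^sub>R s)" .
  have "(LINT x|lborel. ?F x) = s ^ DIM('a) * (LINT x|lborel. ?F (0 + s *\<^sub>R x))"
    using integral_lborel_affine[of ?F s 0] s by simp
  also have "(\<lambda>x. ?F (0 + s *\<^sub>R x)) = (\<lambda>x. cos (x \<bullet> z) * gauss (s *\<^sub>R x))"
    using s by (auto simp: field_simps)
  finally show ?thesis using 1 s by (simp add: field_simps)
qed

subsection \<open>Plancherel's theorem\<close>

lemma one_minus_cos_le: "1 - cos t \<le> t\<^sup>2 / (2::real)"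
proof -
  have "(sin (t / 2))\<^sup>2 \<le> (t / 2)\<^sup>2"
    by (rule abs_le_square_iff[THEN iffD1, OF abs_sin_x_le_abs_x])
  then show ?thesis using cos_double_sin[of "t / 2"] by (simp add: power_divide)
qed

text \<open>The left side is the squared symbol of a translation difference, the right side twice
  the integrand of the multiplier: this is how \<open>1 - cos\<close> enters the energy.\<close>

lemma norm_cis_minus_one_sq: "(norm (cis t - 1))\<^sup>2 = 2 * (1 - cos t)"
  by (simp add: cmod_power2 power2_diff sin_squared_eq)

lemma norm_cis_diff_le: "norm (cis a - cis b) \<le> \<bar>a - b\<bar>"
proof -
  have "cis a - cis b = cis b * (cis (a - b) - 1)"
    by (simp add: right_diff_distrib cis_mult)
  then have "(norm (cis a - cis b))\<^sup>2 = (norm (cis (a - b) - 1))\<^sup>2"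
    by (simp add: norm_mult)
  also have "\<dots> \<le> (a - b)\<^sup>2"
    using mult_left_mono[OF one_minus_cos_le[of "a - b"], of 2] by (simp add: norm_cis_minus_one_sq)
  finally show ?thesis
    by (simp add: abs_le_square_iff[symmetric])
qed

section \<open>The Fourier transform of integrable functions\<close>

definition fourier :: "('a::euclidean_space \<Rightarrow> real) \<Rightarrow> 'a \<Rightarrow> complex" where
  "fourier u \<xi> = (LINT x|lborel. u x *\<^sub>R cis (\<xi> \<bullet> x))"

lemma integrable_scaleR_cis:
  assumes "integrable lborel u"
  shows "integrable lborel (\<lambda>x. u x *\<^sub>R cis (\<xi> \<bullet> x))"
proof -
  have [measurable]: "u \<in> borel_measurable borel"
    using assms by (auto dest: borel_measurable_integrable)
  show ?thesis
    using assms by (rule Bochner_Integration.integrable_bound) (auto simp: cis_conv_exp)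
qed

lemma integrable_mult_cos_sin:
  fixes u :: "'a::euclidean_space \<Rightarrow> real"
  assumes "integrable lborel u"
  shows "integrable lborel (\<lambda>x. u x * cos (\<xi> \<bullet> x))" "integrable lborel (\<lambda>x. u x * sin (\<xi> \<bullet> x))"
proof -
  have [measurable]: "u \<in> borel_measurable borel"
    using assms by (auto dest: borel_measurable_integrable)
  show "integrable lborel (\<lambda>x. u x * cos (\<xi> \<bullet> x))"
    using assms by (rule Bochner_Integration.integrable_bound) (auto simp: abs_mult mult_left_le)
  show "integrable lborel (\<lambda>x. u x * sin (\<xi> \<bullet> x))"
    using assms by (rule Bochner_Integration.integrable_bound) (auto simp: abs_mult mult_left_le)
qed

lemma borel_measurable_fourier [measurable]:
  assumes [measurable]: "u \<in> borel_measurable borel"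
  shows "fourier u \<in> borel_measurable borel"
  unfolding fourier_def[abs_def] cis_conv_exp by measurable

lemma norm_fourier_le:
  assumes "integrable lborel u"
  shows "norm (fourier u \<xi>) \<le> (LINT x|lborel. \<bar>u x\<bar>)"
  unfolding fourier_def using integral_norm_bound[of lborel "\<lambda>x. u x *\<^sub>R cis (\<xi> \<bullet> x)"] by simp

lemma fourier_shift:
  assumes u: "integrable lborel u"
  shows "fourier (\<lambda>x. u (x + z)) \<xi> = cis (- (\<xi> \<bullet> z)) * fourier u \<xi>"
proof -
  have [measurable]: "u \<in> borel_measurable borel"
    using u by (auto dest: borel_measurable_integrable)
  have "fourier (\<lambda>x. u (x + z)) \<xi> = (LINT x|lborel. cis (- (\<xi> \<bullet> z)) * (u (x + z) *\<^sub>R cis (\<xi> \<bullet> (x + z))))"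
    unfolding fourier_def
    by (intro Bochner_Integration.integral_cong refl) (simp add: inner_add_right cis_mult)
  also have "\<dots> = cis (- (\<xi> \<bullet> z)) * (LINT x|lborel. u (x + z) *\<^sub>R cis (\<xi> \<bullet> (x + z)))"
    by (rule integral_mult_right_zero)
  also have "(LINT x|lborel. u (x + z) *\<^sub>R cis (\<xi> \<bullet> (x + z))) = fourier u \<xi>"
    unfolding fourier_def cis_conv_exp
    by (rule integral_lborel_shift[of "\<lambda>x. u x *\<^sub>R exp (\<i> * complex_of_real (\<xi> \<bullet> x))"]) measurable
  finally show ?thesis .
qed

lemma fourier_diff:
  assumes "integrable lborel u" "integrable lborel v"
  shows "fourier (\<lambda>x. u x - v x) \<xi> = fourier u \<xi> - fourier v \<xi>"
  unfolding fourier_def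
  using integrable_scaleR_cis[OF assms(1)] integrable_scaleR_cis[OF assms(2)]
  by (simp add: scaleR_diff_left)

text \<open>On the support of \<open>u\<close> the phases at two frequencies differ by at most R
  |\<xi> - \<eta>|. The constant depends on \<open>u\<close> only through its L1 norm, which yields
  equicontinuity of a bounded family.\<close>

lemma fourier_lipschitz:
  assumes u: "u \<in> L2 (cball 0 R)"
  shows "norm (fourier u \<xi> - fourier u \<eta>) \<le> R * norm (\<xi> - \<eta>) * (LINT x|lborel. \<bar>u x\<bar>)"
proof -
  note u1 = L2_integrable(1)[OF u bounded_cball]
  have [measurable]: "u \<in> borel_measurable borel" using u by (auto simp: L2_def)
  have int: "integrable lborel (\<lambda>x. u x *\<^sub>R cis (\<xi> \<bullet> x) - u x *\<^sub>R cis (\<eta> \<bullet> x))"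
    by (intro Bochner_Integration.integrable_diff integrable_scaleR_cis u1)
  have "fourier u \<xi> - fourier u \<eta> = (LINT x|lborel. u x *\<^sub>R cis (\<xi> \<bullet> x) - u x *\<^sub>R cis (\<eta> \<bullet> x))"
    unfolding fourier_def
    by (rule Bochner_Integration.integral_diff[symmetric]; rule integrable_scaleR_cis[OF u1])
  also have "norm \<dots> \<le> (LINT x|lborel. norm (u x *\<^sub>R cis (\<xi> \<bullet> x) - u x *\<^sub>R cis (\<eta> \<bullet> x)))"
    by (rule integral_norm_bound)
  also have "\<dots> \<le> (LINT x|lborel. R * norm (\<xi> - \<eta>) * \<bar>u x\<bar>)"
  proof (rule integral_mono_AE)
    show "AE x in lborel. norm (u x *\<^sub>R cis (\<xi> \<bullet> x) - u x *\<^sub>R cis (\<eta> \<bullet> x)) \<le> R * norm (\<xi> - \<eta>) * \<bar>u x\<bar>"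
    proof -
      have "AE x in lborel. x \<notin> cball 0 R \<longrightarrow> u x = 0" using u by (auto simp: L2_def)
      then show ?thesis
      proof eventually_elim
        case (elim x)
        show ?case
        proof (cases "u x = 0")
          case False
          then have x: "norm x \<le> R" using elim by auto
          have "norm (u x *\<^sub>R cis (\<xi> \<bullet> x) - u x *\<^sub>R cis (\<eta> \<bullet> x)) = \<bar>u x\<bar> * norm (cis (\<xi> \<bullet> x) - cis (\<eta> \<bullet> x))"
            by (simp flip: scaleR_diff_right)
          also have "\<dots> \<le> \<bar>u x\<bar> * \<bar>(\<xi> - \<eta>) \<bullet> x\<bar>"
            using norm_cis_diff_le[of "\<xi> \<bullet> x" "\<eta> \<bullet> x"] by (intro mult_left_mono) (auto simp: inner_diff_left)
          also have "\<dots> \<le> \<bar>u x\<bar> * (norm (\<xi> - \<eta>) * R)"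
            by (intro mult_left_mono order_trans[OF Cauchy_Schwarz_ineq2] x) auto
          finally show ?thesis by (simp add: mult_ac)
        qed simp
      qed
    qed
  qed (use int u1 in auto)
  finally show ?thesis by simp
qed

text \<open>The squares of the real and imaginary parts combine, by the formula for the cosine of a
  difference, into a real kernel of \<open>x - y\<close> that can be integrated in the
  frequency.\<close>

lemma norm_fourier_sq:
  fixes u :: "'a::euclidean_space \<Rightarrow> real"
  assumes u: "integrable lborel u"
  shows "(norm (fourier u \<xi>))\<^sup>2 = (LINT x|lborel. LINT y|lborel. u x * u y * cos (\<xi> \<bullet> (x - y)))"
proof -
  define C where "C = (LINT x|lborel. u x * cos (\<xi> \<bullet> x))"
  define S where "S = (LINT x|lborel. u x * sin (\<xi> \<bullet> x))"
  note int = integrable_mult_cos_sin[OF u]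
  have "Re (fourier u \<xi>) = C" "Im (fourier u \<xi>) = S"
    using integral_Re[OF integrable_scaleR_cis[OF u]] integral_Im[OF integrable_scaleR_cis[OF u]]
    by (simp_all add: fourier_def C_def S_def)
  then have "(norm (fourier u \<xi>))\<^sup>2 = C * C + S * S"
    by (simp add: cmod_def power2_eq_square)
  also have "C * C = (LINT x|lborel. u x * cos (\<xi> \<bullet> x) * C)"
    by (simp add: C_def)
  also have "S * S = (LINT x|lborel. u x * sin (\<xi> \<bullet> x) * S)"
    by (simp add: S_def)
  also have "(LINT x|lborel. u x * cos (\<xi> \<bullet> x) * C) + (LINT x|lborel. u x * sin (\<xi> \<bullet> x) * S)
      = (LINT x|lborel. u x * cos (\<xi> \<bullet> x) * C + u x * sin (\<xi> \<bullet> x) * S)"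
    by (intro Bochner_Integration.integral_add[symmetric] integrable_mult_left int)
  also have "\<dots> = (LINT x|lborel. LINT y|lborel. u x * u y * cos (\<xi> \<bullet> (x - y)))"
  proof (intro Bochner_Integration.integral_cong refl)
    fix x
    have "u x * cos (\<xi> \<bullet> x) * C + u x * sin (\<xi> \<bullet> x) * S
        = (LINT y|lborel. u x * cos (\<xi> \<bullet> x) * (u y * cos (\<xi> \<bullet> y)))
          + (LINT y|lborel. u x * sin (\<xi> \<bullet> x) * (u y * sin (\<xi> \<bullet> y)))"
      by (simp add: C_def S_def)
    also have "\<dots> = (LINT y|lborel. u x * cos (\<xi> \<bullet> x) * (u y * cos (\<xi> \<bullet> y))
          + u x * sin (\<xi> \<bullet> x) * (u y * sin (\<xi> \<bullet> y)))"
      by (intro Bochner_Integration.integral_add[symmetric] integrable_mult_right int)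
    also have "\<dots> = (LINT y|lborel. u x * u y * cos (\<xi> \<bullet> (x - y)))"
      by (intro Bochner_Integration.integral_cong refl)
         (simp add: inner_diff_right cos_diff algebra_simps)
    finally show "u x * cos (\<xi> \<bullet> x) * C + u x * sin (\<xi> \<bullet> x) * S
        = (LINT y|lborel. u x * u y * cos (\<xi> \<bullet> (x - y)))" .
  qed
  finally show ?thesis .
qed

section \<open>Autocorrelation and the removal of the Gaussian weight\<close>

lemma (in pair_sigma_finite) integrable_mult_fst_snd:
  fixes f :: "'a \<Rightarrow> real" and g :: "'b \<Rightarrow> real"
  assumes f: "integrable M1 f" and g: "integrable M2 g"
  shows "integrable (M1 \<Otimes>\<^sub>M M2) (\<lambda>p. f (fst p) * g (snd p))"
proof (rule Fubini_integrable)
  have [measurable]: "f \<in> borel_measurable M1" "g \<in> borel_measurable M2"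
    using f g by (auto dest: borel_measurable_integrable)
  show "(\<lambda>p. f (fst p) * g (snd p)) \<in> borel_measurable (M1 \<Otimes>\<^sub>M M2)" by measurable
  show "integrable M1 (\<lambda>x. LINT y|M2. norm (f (fst (x, y)) * g (snd (x, y))))"
    using f by (simp add: abs_mult)
qed (use g in simp)

text \<open>Up to a constant, the inverse transform of |F u|^2 (Wiener-Khinchin); its value at 0 is
  the squared L2 norm.\<close>

definition autocorr :: "('a::euclidean_space \<Rightarrow> real) \<Rightarrow> 'a \<Rightarrow> real" where
  "autocorr u h = (LINT x|lborel. u x * u (x + h))"

text \<open>From 2|ab| \<le> a^2 + b^2 and translation invariance. The bound is uniform in
  \<open>h\<close>, so it can serve as a majorant under the Gaussian average.\<close>

lemma integrable_autocorr:
  fixes u :: "'a::euclidean_space \<Rightarrow> real"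
  assumes u: "u \<in> L2 (cball 0 R)"
  shows "integrable lborel (\<lambda>x. u x * u (x + h))"
    and "(LINT x|lborel. \<bar>u x * u (x + h)\<bar>) \<le> (LINT x|lborel. (u x)\<^sup>2)"
proof -
  note sq = L2_integrable(2)[OF u bounded_cball]
  have [measurable]: "u \<in> borel_measurable borel" using u by (auto simp: L2_def)
  note sqh = integrable_lborel_shift[OF sq, of h]
  have int: "integrable lborel (\<lambda>x. ((u x)\<^sup>2 + (u (x + h))\<^sup>2) / 2)"
    using sq sqh by auto
  have le: "\<bar>u x * u (x + h)\<bar> \<le> ((u x)\<^sup>2 + (u (x + h))\<^sup>2) / 2" for x
    using zero_le_power2[of "\<bar>u x\<bar> - \<bar>u (x + h)\<bar>"] by (simp add: power2_eq_square algebra_simps abs_mult)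
  show 1: "integrable lborel (\<lambda>x. u x * u (x + h))"
    using int by (rule Bochner_Integration.integrable_bound) (use le in \<open>auto intro: order_trans\<close>)
  have "(LINT x|lborel. \<bar>u x * u (x + h)\<bar>) \<le> (LINT x|lborel. ((u x)\<^sup>2 + (u (x + h))\<^sup>2) / 2)"
    using 1 int le by (intro integral_mono) auto
  also have "\<dots> = (LINT x|lborel. (u x)\<^sup>2)"
    using sq sqh integral_lborel_shift[of "\<lambda>x. (u x)\<^sup>2" h] by simp
  finally show "(LINT x|lborel. \<bar>u x * u (x + h)\<bar>) \<le> (LINT x|lborel. (u x)\<^sup>2)" .
qed

lemma abs_autocorr_le:
  assumes u: "u \<in> L2 (cball 0 R)"
  shows "\<bar>autocorr u h\<bar> \<le> (LINT x|lborel. (u x)\<^sup>2)"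
  unfolding autocorr_def
  using integral_norm_bound[of lborel "\<lambda>x. u x * u (x + h)"] integrable_autocorr(2)[OF u, of h]
  by (simp add: abs_mult)

text \<open>Polarization: the autocorrelation at \<open>h\<close> is the squared norm of
  \<open>u\<close> minus half the squared norm of \<open>u (x + h) - u x\<close>, and translation is
  continuous in L2.\<close>

lemma autocorr_tendsto:
  fixes u :: "'a::euclidean_space \<Rightarrow> real"
  assumes u: "u \<in> L2 (cball 0 R)" and h: "h \<longlonglongrightarrow> 0"
  shows "(\<lambda>n. autocorr u (h n)) \<longlonglongrightarrow> (LINT x|lborel. (u x)\<^sup>2)"
proof -
  have [measurable]: "u \<in> borel_measurable borel" using u by (auto simp: L2_def)
  note sq = L2_integrable(2)[OF u bounded_cball]
  let ?D = "\<lambda>h. LINT x|lborel. (u (x + h) - u x)\<^sup>2"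
  have eq: "autocorr u h = (LINT x|lborel. (u x)\<^sup>2) - ?D h / 2" for h
  proof -
    have "?D h = (LINT x|lborel. (u (x + h))\<^sup>2 + (u x)\<^sup>2 - 2 * (u x * u (x + h)))"
      by (intro Bochner_Integration.integral_cong refl) (simp add: power2_eq_square algebra_simps)
    also have "\<dots> = (LINT x|lborel. (u x)\<^sup>2) + (LINT x|lborel. (u x)\<^sup>2) - 2 * autocorr u h"
      using sq integrable_lborel_shift[OF sq, of h] integral_lborel_shift[of "\<lambda>x. (u x)\<^sup>2" h]
        integrable_autocorr(1)[OF u, of h]
      by (simp add: autocorr_def)
    finally show ?thesis by (simp add: field_simps)
  qed
  have "L2_nn (\<lambda>x. u (x + h) - u x) = ennreal (?D h)" for h
  proof (rule L2_nn_eq_integral)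
    show "(\<lambda>x. u (x + h) - u x) \<in> L2 (cball 0 (R + norm h))"
      by (intro L2_diff L2_shift[OF u] order_refl L2_mono[OF u] subset_cball) simp
  qed simp
  then have "(\<lambda>n. ?D (h n)) \<longlonglongrightarrow> 0"
    using L2_translation_continuous[OF u h] by (simp add: ennreal_tendsto_0_iff)
  then have "(\<lambda>n. (LINT x|lborel. (u x)\<^sup>2) - ?D (h n) / 2) \<longlonglongrightarrow> (LINT x|lborel. (u x)\<^sup>2) - 0 / 2"
    by (intro tendsto_intros) auto
  then show ?thesis by (simp add: eq)
qed

text \<open>The weight makes the triple integral over frequency, \<open>x\<close> and
  \<open>y\<close> absolutely convergent. Integrating the frequency first gives a Gaussian kernel of
  width \<open>s\<close> in \<open>x - y\<close>; the substitution y = x + s t absorbs its factor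
  s^-d and leaves an average of the autocorrelation.\<close>

lemma gauss_weighted_fourier:
  fixes u :: "'a::euclidean_space \<Rightarrow> real"
  assumes u: "u \<in> L2 (cball 0 R)" and s: "s > 0"
  shows "(LINT \<xi>|lborel. (norm (fourier u \<xi>))\<^sup>2 * gauss (s *\<^sub>R \<xi>))
    = sqrt (2 * pi) ^ DIM('a) * (LINT t|lborel. gauss t * autocorr u (s *\<^sub>R t))"
    (is "?L = ?c * _")
proof -
  interpret L: pair_sigma_finite "lborel :: 'a measure" "lborel \<Otimes>\<^sub>M lborel :: ('a \<times> 'a) measure"
    by (intro pair_sigma_finite.intro sigma_finite_lborel lborel_pair.P.sigma_finite_measure_axioms)
  note u1 = L2_integrable(1)[OF u bounded_cball]
  have [measurable]: "u \<in> borel_measurable borel" using u by (auto simp: L2_def)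
  define U where "U p = u (fst p) * u (snd p)" for p
  have [measurable]: "U \<in> borel_measurable (borel \<Otimes>\<^sub>M borel)" unfolding U_def[abs_def] by measurable
  have U: "integrable (lborel \<Otimes>\<^sub>M lborel) U"
    unfolding U_def[abs_def] by (rule lborel_pair.integrable_mult_fst_snd[OF u1 u1])
  have gs: "integrable lborel (\<lambda>\<xi>::'a. gauss (s *\<^sub>R \<xi>))"
    using integrable_lborel_affine[OF integrable_gauss s, of 0] by simp
  define f where "f \<xi> p = gauss (s *\<^sub>R \<xi>) * U p * cos (\<xi> \<bullet> (fst p - snd p))" for \<xi> p
  have f: "integrable (lborel \<Otimes>\<^sub>M (lborel \<Otimes>\<^sub>M lborel)) (\<lambda>(\<xi>, p). f \<xi> p)"
    using L.integrable_mult_fst_snd[OF gs U]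
    by (rule Bochner_Integration.integrable_bound)
       (auto simp: f_def abs_mult mult_left_le split_beta')
  have fp: "integrable (lborel \<Otimes>\<^sub>M lborel) (f \<xi>)" for \<xi>
    unfolding f_def using integrable_mult_right[OF U, of "gauss (s *\<^sub>R \<xi>)"]
    by (rule Bochner_Integration.integrable_bound) (auto simp: abs_mult mult_left_le)
  have "?L = (LINT \<xi>|lborel. LINT p|(lborel \<Otimes>\<^sub>M lborel). f \<xi> p)"
  proof (intro Bochner_Integration.integral_cong refl)
    fix \<xi> :: 'a
    have "(LINT p|(lborel \<Otimes>\<^sub>M lborel). f \<xi> p) = (LINT x|lborel. LINT y|lborel. f \<xi> (x, y))"
      by (rule lborel_pair.integral_fst'[OF fp, symmetric])
    also have "\<dots> = (LINT x|lborel. LINT y|lborel. gauss (s *\<^sub>R \<xi>) * (u x * u y * cos (\<xi> \<bullet> (x - y))))"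
      by (simp add: f_def U_def mult.assoc)
    also have "\<dots> = gauss (s *\<^sub>R \<xi>) * (norm (fourier u \<xi>))\<^sup>2"
      by (simp add: norm_fourier_sq[OF u1])
    finally show "(norm (fourier u \<xi>))\<^sup>2 * gauss (s *\<^sub>R \<xi>) = (LINT p|(lborel \<Otimes>\<^sub>M lborel). f \<xi> p)"
      by simp
  qed
  also have "\<dots> = (LINT p|(lborel \<Otimes>\<^sub>M lborel). LINT \<xi>|lborel. f \<xi> p)"
    by (rule L.Fubini_integral[OF f, symmetric])
  also have "\<dots> = (LINT p|(lborel \<Otimes>\<^sub>M lborel). U p * (?c / s ^ DIM('a) * gauss ((fst p - snd p) /\<^sub>R s)))"
  proof (intro Bochner_Integration.integral_cong refl)
    fix p :: "'a \<times> 'a"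
    have "(LINT \<xi>|lborel. f \<xi> p) = (LINT \<xi>|lborel. U p * (cos (\<xi> \<bullet> (fst p - snd p)) * gauss (s *\<^sub>R \<xi>)))"
      by (intro Bochner_Integration.integral_cong refl) (simp add: f_def)
    then show "(LINT \<xi>|lborel. f \<xi> p) = U p * (?c / s ^ DIM('a) * gauss ((fst p - snd p) /\<^sub>R s))"
      by (simp add: gauss_scaled_cos_integral[OF s])
  qed
  also have "\<dots> = (LINT x|lborel. LINT y|lborel. U (x, y) * (?c / s ^ DIM('a) * gauss ((fst (x, y) - snd (x, y)) /\<^sub>R s)))"
  proof (rule lborel_pair.integral_fst'[symmetric])
    \<comment> \<open>The maximum of the kernel, attained at the origin.\<close>
    let ?C = "?c / s ^ DIM('a) * (1 / sqrt (2 * pi)) ^ DIM('a)"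
    show "integrable (lborel \<Otimes>\<^sub>M lborel) (\<lambda>p. U p * (?c / s ^ DIM('a) * gauss ((fst p - snd p) /\<^sub>R s)))"
      using integrable_mult_left[OF U, of ?C]
    proof (rule Bochner_Integration.integrable_bound)
      show "AE p in lborel \<Otimes>\<^sub>M lborel. norm (U p * (?c / s ^ DIM('a) * gauss ((fst p - snd p) /\<^sub>R s)))
          \<le> norm (U p * ?C)"
      proof (rule AE_I2)
        fix p :: "'a \<times> 'a"
        show "norm (U p * (?c / s ^ DIM('a) * gauss ((fst p - snd p) /\<^sub>R s))) \<le> norm (U p * ?C)"
          unfolding norm_mult using gauss_le[of "(fst p - snd p) /\<^sub>R s"] gauss_pos[of "(fst p - snd p) /\<^sub>R s"]
          by (intro mult_left_mono) auto
      qed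
    qed auto
  qed
  \<comment> \<open>Under y = x + s t the argument of the kernel becomes \<open>- t\<close>, and
    \<open>gauss\<close> is even.\<close>
  also have "\<dots> = (LINT x|lborel. LINT t|lborel. ?c * (gauss t * (u x * u (x + s *\<^sub>R t))))"
  proof (rule Bochner_Integration.integral_cong[OF refl])
    fix x :: 'a
    have "(LINT y|lborel. U (x, y) * (?c / s ^ DIM('a) * gauss ((fst (x, y) - snd (x, y)) /\<^sub>R s)))
      = s ^ DIM('a) *\<^sub>R (LINT t|lborel. U (x, x + s *\<^sub>R t)
          * (?c / s ^ DIM('a) * gauss ((fst (x, x + s *\<^sub>R t) - snd (x, x + s *\<^sub>R t)) /\<^sub>R s)))"
      by (rule integral_lborel_affine[OF _ s]) (simp add: U_def)
    also have "\<dots> = (LINT t|lborel. s ^ DIM('a) * (U (x, x + s *\<^sub>R t)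
          * (?c / s ^ DIM('a) * gauss ((fst (x, x + s *\<^sub>R t) - snd (x, x + s *\<^sub>R t)) /\<^sub>R s))))"
      by simp
    also have "\<dots> = (LINT t|lborel. ?c * (gauss t * (u x * u (x + s *\<^sub>R t))))"
      using s by (intro Bochner_Integration.integral_cong refl) (simp add: U_def)
    finally show "(LINT y|lborel. U (x, y) * (?c / s ^ DIM('a) * gauss ((fst (x, y) - snd (x, y)) /\<^sub>R s)))
      = (LINT t|lborel. ?c * (gauss t * (u x * u (x + s *\<^sub>R t))))" .
  qed
  \<comment> \<open>Integrability is checked with \<open>x\<close> innermost, where the
    autocorrelation bound is uniform in \<open>t\<close> and only the integrable
    \<open>gauss\<close> remains.\<close>
  also have "\<dots> = (LINT t|lborel. LINT x|lborel. ?c * (gauss t * (u x * u (x + s *\<^sub>R t))))"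
  proof (rule lborel_pair.Fubini_integral)
    show "integrable (lborel \<Otimes>\<^sub>M lborel) (\<lambda>(t, x). ?c * (gauss t * (u x * u (x + s *\<^sub>R t))))"
    proof (rule lborel_pair.Fubini_integrable)
      show "AE t in lborel. integrable lborel
          (\<lambda>x. case (t, x) of (t, x) \<Rightarrow> ?c * (gauss t * (u x * u (x + s *\<^sub>R t))))"
        by (intro AE_I2) (auto intro!: integrable_mult_right integrable_autocorr[OF u])
      have "integrable lborel (\<lambda>t::'a. ?c * gauss t * (LINT x|lborel. (u x)\<^sup>2))"
        by (intro integrable_mult_left integrable_mult_right integrable_gauss)
      then show "integrable lborel (\<lambda>t. LINT x|lborel. norm
          (case (t, x) of (t, x) \<Rightarrow> ?c * (gauss t * (u x * u (x + s *\<^sub>R t)))))"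
      proof (rule Bochner_Integration.integrable_bound)
        show "AE t in lborel. norm (LINT x|lborel. norm
            (case (t, x) of (t, x) \<Rightarrow> ?c * (gauss t * (u x * u (x + s *\<^sub>R t)))))
          \<le> norm (?c * gauss t * (LINT x|lborel. (u x)\<^sup>2))"
        proof (rule AE_I2)
          fix t :: 'a
          have "(LINT x|lborel. norm (case (t, x) of (t, x) \<Rightarrow> ?c * (gauss t * (u x * u (x + s *\<^sub>R t)))))
              = ?c * gauss t * (LINT x|lborel. \<bar>u x * u (x + s *\<^sub>R t)\<bar>)"
            using gauss_pos[of t] by (simp add: abs_mult mult.assoc)
          also have "\<dots> \<le> ?c * gauss t * (LINT x|lborel. (u x)\<^sup>2)"
            using gauss_pos[of t] integrable_autocorr(2)[OF u, of "s *\<^sub>R t"]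
            by (intro mult_left_mono) auto
          finally show "norm (LINT x|lborel. norm
              (case (t, x) of (t, x) \<Rightarrow> ?c * (gauss t * (u x * u (x + s *\<^sub>R t)))))
            \<le> norm (?c * gauss t * (LINT x|lborel. (u x)\<^sup>2))"
            by (simp add: abs_le_iff) 
        qed
      qed measurable
    qed measurable
  qed
  also have "\<dots> = ?c * (LINT t|lborel. gauss t * autocorr u (s *\<^sub>R t))"
    by (simp add: autocorr_def)
  finally show ?thesis .
qed

text \<open>\<open>fourier\<close> has no normalising factor. One factor \<open>c\<close> comes from
  transforming the weight, the other from the limit \<open>1 / c\<close> of the weights. As
  \<open>s\<close> decreases to 0 the weights increase, giving monotone convergence on the frequency
  side; the other side converges by domination.\<close>

theorem plancherel:
  fixes u :: "'a::euclidean_space \<Rightarrow> real"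
  assumes u: "u \<in> L2 (cball 0 R)"
  shows "(\<integral>\<^sup>+\<xi>. ennreal ((norm (fourier u \<xi>))\<^sup>2) \<partial>lborel) = ennreal ((2 * pi) ^ DIM('a)) * L2_nn u"
proof -
  note u1 = L2_integrable(1)[OF u bounded_cball]
  have [measurable]: "u \<in> borel_measurable borel" using u by (auto simp: L2_def)
  define N where "N = (LINT x|lborel. (u x)\<^sup>2)"
  define c where "c = sqrt (2 * pi) ^ DIM('a)"
  have c: "c > 0" "c * c = (2 * pi) ^ DIM('a)" unfolding c_def power_mult_distrib[symmetric] by simp_all
  define s where "s n = inverse (real (Suc n))" for n
  have s: "s n > 0" for n by (simp add: s_def)
  have s0: "s \<longlonglongrightarrow> 0" unfolding s_def by (rule LIMSEQ_inverse_real_of_nat)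
  define f where "f n \<xi> = ennreal ((norm (fourier u \<xi>))\<^sup>2 * gauss (s n *\<^sub>R \<xi>))" for n \<xi>
  have [measurable]: "f n \<in> borel_measurable borel" for n unfolding f_def by measurable
  have int: "integral\<^sup>N lborel (f n) = ennreal (c * (LINT t|lborel. gauss t * autocorr u (s n *\<^sub>R t)))" for n
  proof -
    have "integrable lborel (\<lambda>\<xi>::'a. (LINT x|lborel. \<bar>u x\<bar>)\<^sup>2 * gauss (s n *\<^sub>R \<xi>))"
      using integrable_lborel_affine[OF integrable_gauss s, of 0] by (intro integrable_mult_right) simp
    then have "integrable lborel (\<lambda>\<xi>. (norm (fourier u \<xi>))\<^sup>2 * gauss (s n *\<^sub>R \<xi>))"
      by (rule Bochner_Integration.integrable_bound)
         (auto simp: abs_mult intro!: mult_right_mono power_mono norm_fourier_le[OF u1])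
    then show ?thesis
      unfolding f_def c_def gauss_weighted_fourier[OF u s, symmetric]
      by (rule nn_integral_eq_integral) (auto intro!: mult_nonneg_nonneg less_imp_le[OF gauss_pos])
  qed
  have "(\<lambda>n. LINT t|lborel. gauss t * autocorr u (s n *\<^sub>R t)) \<longlonglongrightarrow> (LINT t|lborel. gauss (t::'a) * N)"
  proof (rule integral_dominated_convergence)
    show "integrable lborel (\<lambda>t::'a. gauss t * N)" by (intro integrable_mult_left integrable_gauss)
    show "AE t in lborel. (\<lambda>n. gauss t * autocorr u (s n *\<^sub>R t)) \<longlonglongrightarrow> gauss t * N"
    proof (rule AE_I2)
      fix t :: 'a
      have "(\<lambda>n. s n *\<^sub>R t) \<longlonglongrightarrow> 0" using tendsto_scaleR[OF s0 tendsto_const, of t] by simp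
      then show "(\<lambda>n. gauss t * autocorr u (s n *\<^sub>R t)) \<longlonglongrightarrow> gauss t * N"
        unfolding N_def by (intro tendsto_intros autocorr_tendsto[OF u])
    qed
    show "AE t in lborel. norm (gauss t * autocorr u (s n *\<^sub>R t)) \<le> gauss t * N" for n
      using abs_autocorr_le[OF u] less_imp_le[OF gauss_pos]
      by (intro AE_I2) (auto simp: abs_mult N_def intro!: mult_mono)
  qed (auto simp: autocorr_def)
  then have "(\<lambda>n. integral\<^sup>N lborel (f n)) \<longlonglongrightarrow> ennreal (c * N)"
    unfolding int by (intro tendsto_ennrealI tendsto_mult tendsto_const) (simp add: integral_gauss)
  moreover have mono: "incseq f"
  proof (intro incseq_SucI le_funI)
    fix n and \<xi> :: 'a
    have "s (Suc n) \<le> s n" by (simp add: s_def)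
    then have "norm (s (Suc n) *\<^sub>R \<xi>) \<le> norm (s n *\<^sub>R \<xi>)"
      using s[of n] s[of "Suc n"] by (auto intro!: mult_right_mono)
    then have "gauss (s (Suc n) *\<^sub>R \<xi>) \<ge> gauss (s n *\<^sub>R \<xi>)"
      unfolding gauss_eq by (intro mult_left_mono) (auto intro!: power_mono)
    then show "f n \<xi> \<le> f (Suc n) \<xi>"
      unfolding f_def by (intro ennreal_leI mult_left_mono) auto
  qed
  then have "(\<lambda>n. integral\<^sup>N lborel (f n)) \<longlonglongrightarrow> (SUP n. integral\<^sup>N lborel (f n))"
    by (intro LIMSEQ_SUP) (auto simp: incseq_def le_fun_def intro!: nn_integral_mono)
  ultimately have "(SUP n. integral\<^sup>N lborel (f n)) = ennreal (c * N)"
    by (rule LIMSEQ_unique[rotated])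
  \<comment> \<open>The supremum of the weights is their limit,
    \<open>gauss 0 = 1 / c\<close>.\<close>
  moreover have "(SUP n. f n \<xi>) = ennreal ((norm (fourier u \<xi>))\<^sup>2) * ennreal (1 / c)" for \<xi>
  proof (rule LIMSEQ_unique)
    show "(\<lambda>n. f n \<xi>) \<longlonglongrightarrow> (SUP n. f n \<xi>)"
      using mono by (intro LIMSEQ_SUP) (auto simp: incseq_def le_fun_def)
    have "(\<lambda>n. f n \<xi>) \<longlonglongrightarrow> ennreal ((norm (fourier u \<xi>))\<^sup>2 * ((1 / sqrt (2 * pi)) ^ DIM('a) * exp (- (norm (0 *\<^sub>R \<xi>))\<^sup>2 / 2)))"
      unfolding f_def gauss_eq by (intro tendsto_intros tendsto_ennrealI s0) auto
    then show "(\<lambda>n. f n \<xi>) \<longlonglongrightarrow> ennreal ((norm (fourier u \<xi>))\<^sup>2) * ennreal (1 / c)"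
      using c by (simp add: c_def power_divide flip: ennreal_mult)
  qed
  moreover have "(SUP n. integral\<^sup>N lborel (f n)) = (\<integral>\<^sup>+\<xi>. (SUP n. f n \<xi>) \<partial>lborel)"
    by (rule nn_integral_monotone_convergence_SUP[symmetric, OF mono]) simp
  ultimately have "(\<integral>\<^sup>+\<xi>. ennreal ((norm (fourier u \<xi>))\<^sup>2) \<partial>lborel) * ennreal (1 / c) = ennreal (c * N)"
    by (simp add: nn_integral_multc)
  then have "(\<integral>\<^sup>+\<xi>. ennreal ((norm (fourier u \<xi>))\<^sup>2) \<partial>lborel) * (ennreal (1 / c) * ennreal c) = ennreal (c * N) * ennreal c"
    by (simp flip: mult.assoc)
  moreover have "ennreal (1 / c) * ennreal c = 1" using c by (simp flip: ennreal_mult)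
  moreover have "ennreal (c * N) * ennreal c = ennreal ((2 * pi) ^ DIM('a)) * ennreal N"
    using c by (simp add: N_def mult.commute mult.left_commute flip: ennreal_mult)
  ultimately show ?thesis
    by (simp add: L2_nn_eq_integral[OF u bounded_cball] N_def)
qed

subsection \<open>The energy of a symmetric Levy operator\<close>

lemma symmetric_levy_measureD:
  assumes "symmetric_levy_measure \<mu>"
  shows "sets \<mu> = sets borel" "space \<mu> = UNIV" "emeasure \<mu> {0} = 0"
    "(\<integral>\<^sup>+z. ennreal (min ((norm z)\<^sup>2) 1) \<partial>\<mu>) < \<infinity>"
  using assms sets_eq_imp_space_eq[of \<mu> borel] by (auto simp: symmetric_levy_measure_def)

text \<open>Needed to exchange integrals over \<open>\<mu>\<close> and \<open>lborel\<close>. By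
  Markov's inequality the sets where n min(|z|^2, 1) \<ge> 1 have finite measure; they exhaust
  everything but the origin, a null set.\<close>

lemma sigma_finite_levy_measure:
  fixes \<mu> :: "'a::euclidean_space measure"
  assumes "symmetric_levy_measure \<mu>"
  shows "sigma_finite_measure \<mu>"
proof
  note L = symmetric_levy_measureD[OF assms]
  note [measurable_cong] = L(1)
  let ?w = "\<lambda>z::'a. min ((norm z)\<^sup>2) 1"
  define A where "A n = {z \<in> space \<mu>. 1 \<le> ennreal (real n) * ennreal (?w z)}" for n
  have A: "A n \<in> sets \<mu>" for n unfolding A_def by measurable
  have fin: "emeasure \<mu> (A n) < \<infinity>" for n
  proof -
    have "emeasure \<mu> (A n) \<le> ennreal (real n) * (\<integral>\<^sup>+z. ennreal (?w z) * indicator (space \<mu>) z \<partial>\<mu>)"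
      unfolding A_def by (rule nn_integral_Markov_inequality) measurable
    also have "\<dots> < \<infinity>"
      using L(2,4) by (auto simp: ennreal_mult_less_top)
    finally show ?thesis .
  qed
  have un: "\<Union> (insert {0} (range A)) = space \<mu>"
  proof -
    have "z \<in> \<Union> (insert {0} (range A))" for z
    proof (cases "z = 0")
      case False
      then have "?w z > 0" by auto
      then obtain n :: nat where "1 < real n * ?w z"
        using reals_Archimedean3 by blast
      then have "ennreal 1 \<le> ennreal (real n * ?w z)" by (intro ennreal_leI) simp
      then have "z \<in> A n" using L(2) by (simp add: A_def ennreal_mult)
      then show ?thesis by auto
    qed auto
    then show ?thesis using L(2) by auto
  qed
  show "\<exists>A. countable A \<and> A \<subseteq> sets \<mu> \<and> \<Union> A = space \<mu> \<and> (\<forall>a\<in>A. emeasure \<mu> a \<noteq> \<infinity>)"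
    using A fin un L(1,3) by (intro exI[of _ "insert {0} (range A)"]) (auto simp: less_top[symmetric])
qed

text \<open>In the unit ball \<open>1 - cos\<close> is bounded quadratically, outside it by 2; the
  constant |\<xi>|^2 + 2 covers both regimes.\<close>

lemma integrable_one_minus_cos:
  fixes \<mu> :: "'a::euclidean_space measure"
  assumes "symmetric_levy_measure \<mu>"
  shows "integrable \<mu> (\<lambda>z. 1 - cos (\<xi> \<bullet> z))"
proof -
  note L = symmetric_levy_measureD[OF assms]
  note [measurable_cong] = L(1)
  have "integrable \<mu> (\<lambda>z::'a. min ((norm z)\<^sup>2) 1)"
    using L(4) by (intro integrableI_bounded) auto
  then have "integrable \<mu> (\<lambda>z. ((norm \<xi>)\<^sup>2 + 2) * min ((norm z)\<^sup>2) 1)"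
    by (rule integrable_mult_right)
  then show ?thesis
  proof (rule Bochner_Integration.integrable_bound)
    show "AE z in \<mu>. norm (1 - cos (\<xi> \<bullet> z)) \<le> norm (((norm \<xi>)\<^sup>2 + 2) * min ((norm z)\<^sup>2) 1)"
    proof (rule AE_I2)
      fix z
      have "1 - cos (\<xi> \<bullet> z) \<le> ((norm \<xi>)\<^sup>2 + 2) * min ((norm z)\<^sup>2) 1"
      proof (cases "(norm z)\<^sup>2 \<le> 1")
        case True
        have "(\<xi> \<bullet> z)\<^sup>2 \<le> (norm \<xi> * norm z)\<^sup>2"
          using Cauchy_Schwarz_ineq2[of \<xi> z] by (intro abs_le_square_iff[THEN iffD1]) simp
        then have "(\<xi> \<bullet> z)\<^sup>2 / 2 \<le> (norm \<xi>)\<^sup>2 * (norm z)\<^sup>2"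
          using zero_le_power2[of "norm \<xi> * norm z"] unfolding power_mult_distrib by linarith
        also have "\<dots> \<le> ((norm \<xi>)\<^sup>2 + 2) * (norm z)\<^sup>2" by (intro mult_right_mono) auto
        finally show ?thesis using one_minus_cos_le[of "\<xi> \<bullet> z"] True by simp
      next
        case False
        then show ?thesis using cos_ge_minus_one[of "\<xi> \<bullet> z"] by (simp add: min_def add_increasing)
      qed
      then show "norm (1 - cos (\<xi> \<bullet> z)) \<le> norm (((norm \<xi>)\<^sup>2 + 2) * min ((norm z)\<^sup>2) 1)"
        using cos_le_one[of "\<xi> \<bullet> z"] unfolding real_norm_def by linarith
    qed
  qed measurable
qed

lemma levy_multiplier_nonneg: "levy_multiplier \<mu> \<xi> \<ge> 0"
  unfolding levy_multiplier_def by (rule integral_nonneg_AE) simp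

lemma borel_measurable_levy_multiplier:
  fixes \<mu> :: "'a::euclidean_space measure"
  assumes \<mu>: "symmetric_levy_measure \<mu>"
  shows "levy_multiplier \<mu> \<in> borel_measurable borel"
proof -
  note [measurable_cong] = symmetric_levy_measureD(1)[OF \<mu>]
  interpret \<mu>: sigma_finite_measure \<mu> by (rule sigma_finite_levy_measure[OF \<mu>])
  show ?thesis unfolding levy_multiplier_def[abs_def] by measurable
qed

lemma nn_integral_one_minus_cos:
  assumes "symmetric_levy_measure \<mu>"
  shows "(\<integral>\<^sup>+z. ennreal (1 - cos (\<xi> \<bullet> z)) \<partial>\<mu>) = ennreal (levy_multiplier \<mu> \<xi>)"
  unfolding levy_multiplier_def
  by (rule nn_integral_eq_integral[OF integrable_one_minus_cos[OF assms]]) simp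

text \<open>Tonelli moves the integral over \<open>z\<close> outside, so that Plancherel can be
  applied to one difference at a time.\<close>

lemma nn_integral_levy_B:
  fixes \<mu> :: "'a::euclidean_space measure"
  assumes \<mu>: "symmetric_levy_measure \<mu>" and [measurable]: "u \<in> borel_measurable borel"
  shows "(\<integral>\<^sup>+x. levy_B \<mu> u x \<partial>lborel) = (1/2) * (\<integral>\<^sup>+z. L2_nn (\<lambda>x. u (x + z) - u x) \<partial>\<mu>)"
proof -
  note [measurable_cong] = symmetric_levy_measureD(1)[OF \<mu>]
  interpret \<mu>: sigma_finite_measure \<mu> by (rule sigma_finite_levy_measure[OF \<mu>])
  interpret P: pair_sigma_finite lborel \<mu>
    by (intro pair_sigma_finite.intro sigma_finite_lborel \<mu>.sigma_finite_measure_axioms)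
  have "(\<integral>\<^sup>+x. levy_B \<mu> u x \<partial>lborel)
      = (1/2) * (\<integral>\<^sup>+x. \<integral>\<^sup>+z. ennreal ((u (x + z) - u x)\<^sup>2) \<partial>\<mu> \<partial>lborel)"
    unfolding levy_B_def by (rule nn_integral_cmult) measurable
  also have "(\<integral>\<^sup>+x. \<integral>\<^sup>+z. ennreal ((u (x + z) - u x)\<^sup>2) \<partial>\<mu> \<partial>lborel)
      = (\<integral>\<^sup>+z. \<integral>\<^sup>+x. ennreal ((u (x + z) - u x)\<^sup>2) \<partial>lborel \<partial>\<mu>)"
    by (rule P.Fubini'[symmetric]) measurable
  finally show ?thesis by (simp add: L2_nn_def)
qed

text \<open>Cancels the 1/2 in \<open>levy_B\<close> against the 2 in
  \<open>norm_cis_minus_one_sq\<close>, by passing through real arithmetic.\<close>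

lemma half_mult_double_ennreal: "1 / 2 * (2 * a) = (a::ennreal)"
proof -
  have "1 / 2 * (2::ennreal) = ennreal (1 / 2) * ennreal 2"
    using divide_ennreal[of 1 2] unfolding ennreal_1 ennreal_numeral by simp
  also have "\<dots> = 1" by (subst ennreal_mult[symmetric]) auto
  finally show ?thesis by (simp add: mult.assoc[symmetric])
qed

text \<open>For fixed \<open>z\<close> the difference \<open>u (x + z) - u x\<close> still has
  bounded support, and its transform is
  \<open>(cis (- (\<xi> \<bullet> z)) - 1) * fourier u \<xi>\<close>. Plancherel yields
  \<open>2 * (1 - cos (\<xi> \<bullet> z))\<close> as the weight, and integration over
  \<open>\<mu>\<close> turns \<open>1 - cos\<close> into the multiplier.\<close>

theorem levy_energy_eq_fourier:
  fixes \<mu> :: "'a::euclidean_space measure"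
  assumes \<mu>: "symmetric_levy_measure \<mu>" and u: "u \<in> L2 (cball 0 R)"
  shows "ennreal ((2 * pi) ^ DIM('a)) * (\<integral>\<^sup>+x. levy_B \<mu> u x \<partial>lborel)
    = (\<integral>\<^sup>+\<xi>. ennreal (levy_multiplier \<mu> \<xi> * (norm (fourier u \<xi>))\<^sup>2) \<partial>lborel)"
proof -
  note [measurable_cong] = symmetric_levy_measureD(1)[OF \<mu>]
  interpret \<mu>: sigma_finite_measure \<mu> by (rule sigma_finite_levy_measure[OF \<mu>])
  interpret P: pair_sigma_finite lborel \<mu>
    by (intro pair_sigma_finite.intro sigma_finite_lborel \<mu>.sigma_finite_measure_axioms)
  note u1 = L2_integrable(1)[OF u bounded_cball]
  have [measurable]: "u \<in> borel_measurable borel" using u by (auto simp: L2_def)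
  let ?c = "ennreal ((2 * pi) ^ DIM('a))"
  have shift: "?c * L2_nn (\<lambda>x. u (x + z) - u x)
      = (\<integral>\<^sup>+\<xi>. 2 * (ennreal (1 - cos (\<xi> \<bullet> z)) * ennreal ((norm (fourier u \<xi>))\<^sup>2)) \<partial>lborel)" for z
  proof -
    have eq: "(norm (fourier (\<lambda>x. u (x + z) - u x) \<xi>))\<^sup>2 = 2 * ((1 - cos (\<xi> \<bullet> z)) * (norm (fourier u \<xi>))\<^sup>2)" for \<xi>
    proof -
      have "fourier (\<lambda>x. u (x + z) - u x) \<xi> = (cis (- (\<xi> \<bullet> z)) - 1) * fourier u \<xi>"
        unfolding fourier_diff[OF integrable_lborel_shift[OF u1] u1] fourier_shift[OF u1]
        by (simp add: left_diff_distrib)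
      moreover have "(norm (cis (- (\<xi> \<bullet> z)) - 1))\<^sup>2 = 2 * (1 - cos (\<xi> \<bullet> z))"
        by (simp add: norm_cis_minus_one_sq)
      ultimately show ?thesis by (simp add: norm_mult power_mult_distrib)
    qed
    have "(\<lambda>x. u (x + z) - u x) \<in> L2 (cball 0 (R + norm z))"
      by (intro L2_diff L2_shift[OF u] order_refl L2_mono[OF u] subset_cball) simp
    then have "?c * L2_nn (\<lambda>x. u (x + z) - u x)
        = (\<integral>\<^sup>+\<xi>. ennreal ((norm (fourier (\<lambda>x. u (x + z) - u x) \<xi>))\<^sup>2) \<partial>lborel)"
      by (rule plancherel[symmetric])
    then show ?thesis unfolding eq by (simp add: ennreal_mult)
  qed
  have "?c * (\<integral>\<^sup>+x. levy_B \<mu> u x \<partial>lborel) = (1/2) * (?c * (\<integral>\<^sup>+z. L2_nn (\<lambda>x. u (x + z) - u x) \<partial>\<mu>))"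
    by (simp add: nn_integral_levy_B[OF \<mu>] mult.left_commute)
  also have "?c * (\<integral>\<^sup>+z. L2_nn (\<lambda>x. u (x + z) - u x) \<partial>\<mu>) = (\<integral>\<^sup>+z. ?c * L2_nn (\<lambda>x. u (x + z) - u x) \<partial>\<mu>)"
    unfolding L2_nn_def by (rule nn_integral_cmult[symmetric]) measurable
  also have "\<dots> = (\<integral>\<^sup>+\<xi>. \<integral>\<^sup>+z. 2 * (ennreal (1 - cos (\<xi> \<bullet> z)) * ennreal ((norm (fourier u \<xi>))\<^sup>2)) \<partial>\<mu> \<partial>lborel)"
    unfolding shift by (rule P.Fubini') measurable
  also have "\<dots> = (\<integral>\<^sup>+\<xi>. 2 * ennreal (levy_multiplier \<mu> \<xi> * (norm (fourier u \<xi>))\<^sup>2) \<partial>lborel)"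
    using levy_multiplier_nonneg[of \<mu>]
    by (simp add: nn_integral_cmult nn_integral_multc nn_integral_one_minus_cos[OF \<mu>] ennreal_mult)
  also have "\<dots> = 2 * (\<integral>\<^sup>+\<xi>. ennreal (levy_multiplier \<mu> \<xi> * (norm (fourier u \<xi>))\<^sup>2) \<partial>lborel)"
    unfolding levy_multiplier_def by (rule nn_integral_cmult) measurable
  also have "1 / 2 * (2 * (\<integral>\<^sup>+\<xi>. ennreal (levy_multiplier \<mu> \<xi> * (norm (fourier u \<xi>))\<^sup>2) \<partial>lborel))
      = (\<integral>\<^sup>+\<xi>. ennreal (levy_multiplier \<mu> \<xi> * (norm (fourier u \<xi>))\<^sup>2) \<partial>lborel)"
    by (rule half_mult_double_ennreal)
  finally show ?thesis .
qed

subsection \<open>Compactness\<close>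

text \<open>Diagonal extraction on a countable dense set, after which the common Lipschitz constant
  makes the values Cauchy everywhere. Locally uniform convergence as in Arzela-Ascoli is more than
  dominated convergence on balls will ask for.\<close>

lemma pointwise_convergent_subsequence:
  fixes f :: "nat \<Rightarrow> 'a::euclidean_space \<Rightarrow> complex"
  assumes bdd: "\<And>n x. norm (f n x) \<le> M"
    and lip: "\<And>n x y. norm (f n x - f n y) \<le> K * norm (x - y)"
  obtains r :: "nat \<Rightarrow> nat" where "strict_mono r" "\<And>x. convergent (\<lambda>n. f (r n) x)"
proof -
  obtain D :: "'a set" where D: "countable D" "\<And>X. open X \<Longrightarrow> X \<noteq> {} \<Longrightarrow> \<exists>d\<in>D. d \<in> X"
    using countable_dense_exists by metis
  obtain r :: "nat \<Rightarrow> nat" where r: "strict_mono r"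
    and conv: "\<And>x. x \<in> D \<Longrightarrow> \<exists>l. (\<lambda>n. f (r n) x) \<longlonglongrightarrow> l"
    using function_convergent_subsequence[OF D(1), of f M] bdd by metis
  have "Cauchy (\<lambda>n. f (r n) x)" for x
  proof (rule metric_CauchyI)
    fix e :: real assume e: "e > 0"
    \<comment> \<open>\<open>\<bar>K\<bar> + 1\<close> keeps the denominator positive whatever
      \<open>K\<close> is.\<close>
    define d where "d = e / (3 * (\<bar>K\<bar> + 1))"
    have d: "d > 0" using e by (simp add: d_def)
    obtain y where y: "y \<in> D" "y \<in> ball x d"
      using D(2)[of "ball x d"] d by auto
    have close: "norm (f n x - f n y) < e / 3" for n
    proof -
      have "norm (f n x - f n y) \<le> \<bar>K\<bar> * norm (x - y)"
        by (rule order_trans[OF lip mult_right_mono]) auto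
      also have "\<dots> \<le> \<bar>K\<bar> * d" using y by (intro mult_left_mono) (auto simp: dist_norm)
      also have "\<dots> < (\<bar>K\<bar> + 1) * d" using d by simp
      also have "\<dots> = e / 3" by (simp add: d_def field_simps)
      finally show ?thesis .
    qed
    have "Cauchy (\<lambda>n. f (r n) y)" using conv[OF y(1)] convergent_Cauchy unfolding convergent_def by blast
    from metric_CauchyD[OF this, of "e / 3"] e obtain N
      where N: "\<forall>m\<ge>N. \<forall>n\<ge>N. dist (f (r m) y) (f (r n) y) < e / 3" by auto
    have "dist (f (r m) x) (f (r n) x) < e" if "m \<ge> N" "n \<ge> N" for m n
    proof -
      have "dist (f (r m) y) (f (r n) y) < e / 3" using N that by simp
      then show ?thesis
        using close[of "r m"] close[of "r n"] dist_triangle[of "f (r m) x" "f (r n) x" "f (r m) y"]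
          dist_triangle[of "f (r m) y" "f (r n) x" "f (r n) y"]
        by (simp add: dist_norm norm_minus_commute)
    qed
    then show "\<exists>N. \<forall>m\<ge>N. \<forall>n\<ge>N. dist (f (r m) x) (f (r n) x) < e" by blast
  qed
  then show thesis using r by (intro that) (auto simp: Cauchy_convergent_iff)
qed

lemma L1_le_L2:
  fixes u :: "'a::euclidean_space \<Rightarrow> real"
  assumes u: "u \<in> L2 (cball 0 R)"
  shows "(LINT x|lborel. \<bar>u x\<bar>) \<le> measure lborel (cball (0::'a) R) + (LINT x|lborel. (u x)\<^sup>2)"
proof -
  note int = L2_integrable[OF u bounded_cball]
  have ind: "integrable lborel (indicator (cball (0::'a) R) :: 'a \<Rightarrow> real)"
    using integrable_indicator_cball[of 1 0 R] by simp
  have int': "integrable lborel (\<lambda>x. indicator (cball 0 R) x + (u x)\<^sup>2)"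
    by (rule Bochner_Integration.integrable_add[OF ind int(2)])
  have "(LINT x|lborel. \<bar>u x\<bar>) \<le> (LINT x|lborel. indicator (cball 0 R) x + (u x)\<^sup>2)"
  proof (rule integral_mono_AE)
    show "AE x in lborel. \<bar>u x\<bar> \<le> indicator (cball 0 R) x + (u x)\<^sup>2"
      by (rule L2_AE_abs_le[OF u order_refl])
  qed (use int int' in auto)
  also have "\<dots> = measure lborel (cball (0::'a) R) + (LINT x|lborel. (u x)\<^sup>2)"
    by (subst Bochner_Integration.integral_add[OF ind int(2)]) simp
  finally show ?thesis .
qed

lemma H0D:
  assumes u: "u \<in> H0 \<mu> \<Omega>" and C: "H0_norm \<mu> u \<le> C"
  shows "u \<in> L2 \<Omega>" "L2_nn u \<le> ennreal (C\<^sup>2)" "(\<integral>\<^sup>+x. levy_B \<mu> u x \<partial>lborel) \<le> ennreal (C\<^sup>2)"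
proof -
  show "u \<in> L2 \<Omega>" using u by (simp add: H0_def)
  \<comment> \<open>Since \<open>enn2real\<close> maps infinity to 0, the bound on
    \<open>H0_norm\<close> is informative only together with membership in
    \<open>H0\<close>.\<close>
  have fin: "H0_nn \<mu> u < \<infinity>" using u by (simp add: H0_def)
  have "sqrt (enn2real (H0_nn \<mu> u)) \<le> C" using C by (simp add: H0_norm_def)
  then have "enn2real (H0_nn \<mu> u) \<le> C\<^sup>2" by (rule sqrt_le_D)
  then have "H0_nn \<mu> u \<le> ennreal (C\<^sup>2)"
    using fin by (metis ennreal_enn2real ennreal_leI infinity_ennreal_def)
  then show "L2_nn u \<le> ennreal (C\<^sup>2)" "(\<integral>\<^sup>+x. levy_B \<mu> u x \<partial>lborel) \<le> ennreal (C\<^sup>2)"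
    unfolding H0_nn_def by (auto intro: order_trans[rotated])
qed

lemma norm_diff_sq_le: "(norm (a - b))\<^sup>2 \<le> 2 * (norm a)\<^sup>2 + 2 * (norm b)\<^sup>2"
  by (rule order_trans[OF power_mono[OF norm_triangle_ineq4] square_sum_le]) simp

text \<open>At low frequencies both functions are compared with \<open>h\<close>, later their limit;
  at high frequencies 1 \<le> m / K trades squares for energies.\<close>

lemma nn_integral_diff_low_high_le:
  fixes f g h :: "'a::euclidean_space \<Rightarrow> complex"
  assumes [measurable]: "f \<in> borel_measurable borel" "g \<in> borel_measurable borel"
    "h \<in> borel_measurable borel" "m \<in> borel_measurable borel"
    and K: "K > 0" "\<And>\<xi>. norm \<xi> > \<rho> \<Longrightarrow> m \<xi> \<ge> K" "\<And>\<xi>. m \<xi> \<ge> 0"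
  shows "(\<integral>\<^sup>+\<xi>. ennreal ((norm (f \<xi> - g \<xi>))\<^sup>2) \<partial>lborel)
    \<le> 2 * (\<integral>\<^sup>+\<xi>. ennreal ((norm (h \<xi> - f \<xi>))\<^sup>2 * indicator (cball 0 \<rho>) \<xi>) \<partial>lborel)
      + 2 * (\<integral>\<^sup>+\<xi>. ennreal ((norm (h \<xi> - g \<xi>))\<^sup>2 * indicator (cball 0 \<rho>) \<xi>) \<partial>lborel)
      + ennreal (2 / K) * (\<integral>\<^sup>+\<xi>. ennreal (m \<xi> * (norm (f \<xi>))\<^sup>2) \<partial>lborel)
      + ennreal (2 / K) * (\<integral>\<^sup>+\<xi>. ennreal (m \<xi> * (norm (g \<xi>))\<^sup>2) \<partial>lborel)"
    (is "_ \<le> 2 * ?A + 2 * ?B + _ * ?C + _ * ?D")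
proof -
  let ?I = "indicator (cball 0 \<rho>) :: 'a \<Rightarrow> real"
  have [measurable]: "cball (0::'a) \<rho> \<in> sets borel" by simp
  have "(\<integral>\<^sup>+\<xi>. ennreal ((norm (f \<xi> - g \<xi>))\<^sup>2) \<partial>lborel)
    \<le> (\<integral>\<^sup>+\<xi>. 2 * ennreal ((norm (h \<xi> - f \<xi>))\<^sup>2 * ?I \<xi>) + 2 * ennreal ((norm (h \<xi> - g \<xi>))\<^sup>2 * ?I \<xi>)
        + ennreal (2 / K) * ennreal (m \<xi> * (norm (f \<xi>))\<^sup>2)
        + ennreal (2 / K) * ennreal (m \<xi> * (norm (g \<xi>))\<^sup>2) \<partial>lborel)"
  proof (rule nn_integral_mono)
    fix \<xi> :: 'a
    have "(norm (f \<xi> - g \<xi>))\<^sup>2 \<le> 2 * ((norm (h \<xi> - f \<xi>))\<^sup>2 * ?I \<xi>) + 2 * ((norm (h \<xi> - g \<xi>))\<^sup>2 * ?I \<xi>)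
        + 2 / K * (m \<xi> * (norm (f \<xi>))\<^sup>2) + 2 / K * (m \<xi> * (norm (g \<xi>))\<^sup>2)"
    proof (cases "norm \<xi> \<le> \<rho>")
      case True
      have "(norm (f \<xi> - g \<xi>))\<^sup>2 \<le> 2 * (norm (h \<xi> - f \<xi>))\<^sup>2 + 2 * (norm (h \<xi> - g \<xi>))\<^sup>2"
        using norm_diff_sq_le[of "h \<xi> - g \<xi>" "h \<xi> - f \<xi>"] by simp
      then show ?thesis using True K by (simp add: add_increasing2)
    next
      case False
      have sq: "2 * a \<le> 2 / K * (m \<xi> * a)" if "a \<ge> 0" for a
        using K(1) K(2)[of \<xi>] False mult_right_mono[of K "m \<xi>" a] that by (simp add: field_simps)
      have "(norm (f \<xi> - g \<xi>))\<^sup>2 \<le> 2 * (norm (f \<xi>))\<^sup>2 + 2 * (norm (g \<xi>))\<^sup>2"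
        by (rule norm_diff_sq_le)
      also have "\<dots> \<le> 2 / K * (m \<xi> * (norm (f \<xi>))\<^sup>2) + 2 / K * (m \<xi> * (norm (g \<xi>))\<^sup>2)"
        by (intro add_mono sq) auto
      finally show ?thesis using False by simp
    qed
    then have "ennreal ((norm (f \<xi> - g \<xi>))\<^sup>2) \<le> ennreal (2 * ((norm (h \<xi> - f \<xi>))\<^sup>2 * ?I \<xi>) + 2 * ((norm (h \<xi> - g \<xi>))\<^sup>2 * ?I \<xi>)
        + 2 / K * (m \<xi> * (norm (f \<xi>))\<^sup>2) + 2 / K * (m \<xi> * (norm (g \<xi>))\<^sup>2))"
      by (rule ennreal_leI)
    also have "\<dots> = 2 * ennreal ((norm (h \<xi> - f \<xi>))\<^sup>2 * ?I \<xi>) + 2 * ennreal ((norm (h \<xi> - g \<xi>))\<^sup>2 * ?I \<xi>)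
        + ennreal (2 / K) * ennreal (m \<xi> * (norm (f \<xi>))\<^sup>2)
        + ennreal (2 / K) * ennreal (m \<xi> * (norm (g \<xi>))\<^sup>2)"
      using K(1,3) by (simp add: ennreal_mult[symmetric] flip: ennreal_numeral)
    finally show "ennreal ((norm (f \<xi> - g \<xi>))\<^sup>2) \<le> \<dots>" .
  qed
  also have "\<dots> = 2 * ?A + 2 * ?B + ennreal (2 / K) * ?C + ennreal (2 / K) * ?D"
    by (simp add: nn_integral_add nn_integral_cmult)
  finally show ?thesis .
qed

theorem compact_embedding_if_multiplier_tendsto:
  fixes \<mu> :: "'a::euclidean_space measure"
  assumes \<mu>: "symmetric_levy_measure \<mu>" and \<Omega>: "bounded \<Omega>"
    and lim: "\<And>K. \<forall>\<^sub>F \<xi> in at_infinity. levy_multiplier \<mu> \<xi> > K"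
  shows "compact_embedding (H0 \<mu> \<Omega>) (H0_norm \<mu>) (L2 \<Omega>) L2_norm"
  unfolding compact_embedding_def
proof (intro conjI allI impI)
  show "H0 \<mu> \<Omega> \<subseteq> L2 \<Omega>" by (auto simp: H0_def)
  fix u :: "nat \<Rightarrow> 'a \<Rightarrow> real"
  assume "(\<forall>n. u n \<in> H0 \<mu> \<Omega>) \<and> (\<exists>C. \<forall>n. H0_norm \<mu> (u n) \<le> C)"
  then obtain C where "\<And>n. u n \<in> H0 \<mu> \<Omega>" "\<And>n. H0_norm \<mu> (u n) \<le> C" by blast
  note H = H0D[OF this]
  obtain R where R: "\<Omega> \<subseteq> cball 0 R" 
    using bounded_subset_ballD[OF \<Omega>, of 0] ball_subset_cball by (metis subset_trans)
  have uR: "u n \<in> L2 (cball 0 R)" for n using H(1)[of n] R by (rule L2_mono)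
  have [measurable]: "u n \<in> borel_measurable borel" for n using uR[of n] by (auto simp: L2_def)
  have [measurable]: "levy_multiplier \<mu> \<in> borel_measurable borel"
    by (rule borel_measurable_levy_multiplier[OF \<mu>])
  \<comment> \<open>Bounds the L1 norms, hence all transforms, and gives
    \<open>\<bar>R\<bar> * M\<close> as a common Lipschitz constant.\<close>
  define M where "M = measure lborel (cball (0::'a) R) + C\<^sup>2"
  have L1: "(LINT x|lborel. \<bar>u n x\<bar>) \<le> M" for n
  proof -
    have "(LINT x|lborel. (u n x)\<^sup>2) \<le> C\<^sup>2"
      using H(2)[of n] unfolding L2_nn_eq_integral[OF uR bounded_cball] by simp
    then show ?thesis using L1_le_L2[OF uR[of n]] by (simp add: M_def)
  qed
  have bdd: "norm (fourier (u n) \<xi>) \<le> M" for n \<xi>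
    using norm_fourier_le[OF L2_integrable(1)[OF uR bounded_cball]] L1 by (rule order_trans)
  have "norm (fourier (u n) \<xi> - fourier (u n) \<eta>) \<le> (\<bar>R\<bar> * M) * norm (\<xi> - \<eta>)" for n \<xi> \<eta>
  proof -
    have "norm (fourier (u n) \<xi> - fourier (u n) \<eta>) \<le> R * norm (\<xi> - \<eta>) * (LINT x|lborel. \<bar>u n x\<bar>)"
      by (rule fourier_lipschitz[OF uR])
    also have "\<dots> \<le> \<bar>R\<bar> * norm (\<xi> - \<eta>) * M"
      by (intro mult_mono L1) auto
    finally show ?thesis by (simp add: mult_ac)
  qed
  from pointwise_convergent_subsequence[of "\<lambda>n. fourier (u n)", OF bdd this]
  obtain r where r: "strict_mono r" and conv: "\<And>\<xi>. convergent (\<lambda>n. fourier (u (r n)) \<xi>)" by metis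
  define U where "U \<xi> = lim (\<lambda>n. fourier (u (r n)) \<xi>)" for \<xi>
  have U: "(\<lambda>n. fourier (u (r n)) \<xi>) \<longlonglongrightarrow> U \<xi>" for \<xi>
    using conv[of \<xi>] by (simp add: U_def convergent_LIMSEQ_iff)
  have [measurable]: "U \<in> borel_measurable borel"
    by (rule borel_measurable_LIMSEQ_metric[OF _ U]) simp
  let ?c = "ennreal ((2 * pi) ^ DIM('a))"
  \<comment> \<open>The low-frequency error. For each fixed radius it tends to 0 by dominated
    convergence, with majorant \<open>(2 * M)\<^sup>2\<close> on the ball.\<close>
  define a where "a \<rho> n = (\<integral>\<^sup>+\<xi>. ennreal ((norm (U \<xi> - fourier (u (r n)) \<xi>))\<^sup>2 * indicator (cball 0 \<rho>) \<xi>) \<partial>lborel)" for \<rho> n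
  have a: "a \<rho> \<longlonglongrightarrow> 0" for \<rho>
  proof -
    have [measurable]: "cball (0::'a) \<rho> \<in> sets borel" by simp
    have "a \<rho> \<longlonglongrightarrow> (\<integral>\<^sup>+\<xi>. (0::ennreal) \<partial>(lborel::'a measure))"
      unfolding a_def[abs_def]
    proof (rule nn_integral_dominated_convergence[where w = "\<lambda>\<xi>. ennreal ((2 * M)\<^sup>2 * indicator (cball 0 \<rho>) \<xi>)"])
      show "AE \<xi> in lborel. ennreal ((norm (U \<xi> - fourier (u (r n)) \<xi>))\<^sup>2 * indicator (cball 0 \<rho>) \<xi>)
          \<le> ennreal ((2 * M)\<^sup>2 * indicator (cball 0 \<rho>) \<xi>)" for n
      proof (intro AE_I2 ennreal_leI mult_right_mono power_mono)
        fix \<xi>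
        have "norm (U \<xi>) \<le> M" by (rule LIMSEQ_le_const2[OF tendsto_norm[OF U]]) (auto intro: bdd)
        then show "norm (U \<xi> - fourier (u (r n)) \<xi>) \<le> 2 * M"
          using norm_triangle_ineq4[of "U \<xi>" "fourier (u (r n)) \<xi>"] bdd[of "r n" \<xi>] by linarith
      qed auto
      have "integrable lborel (\<lambda>\<xi>::'a. (2 * M)\<^sup>2 * indicator (cball 0 \<rho>) \<xi>)"
        by (rule integrable_indicator_cball)
      from nn_integral_eq_integral[OF this]
      show "(\<integral>\<^sup>+\<xi>. ennreal ((2 * M)\<^sup>2 * indicator (cball 0 \<rho>) \<xi>) \<partial>(lborel::'a measure)) < \<infinity>"
        by (metis (no_types, lifting) AE_I2 ennreal_less_top indicator_pos_le infinity_ennreal_def mult_nonneg_nonneg zero_le_power2)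
      show "AE \<xi> in lborel. (\<lambda>n. ennreal ((norm (U \<xi> - fourier (u (r n)) \<xi>))\<^sup>2 * indicator (cball 0 \<rho>) \<xi>)) \<longlonglongrightarrow> 0"
      proof (rule AE_I2)
        fix \<xi> :: 'a
        have "(\<lambda>n. (norm (U \<xi> - fourier (u (r n)) \<xi>))\<^sup>2 * indicator (cball 0 \<rho>) \<xi>)
            \<longlonglongrightarrow> (norm (U \<xi> - U \<xi>))\<^sup>2 * indicator (cball 0 \<rho>) \<xi>"
          by (intro tendsto_intros U)
        from tendsto_ennrealI[OF this]
        show "(\<lambda>n. ennreal ((norm (U \<xi> - fourier (u (r n)) \<xi>))\<^sup>2 * indicator (cball 0 \<rho>) \<xi>)) \<longlonglongrightarrow> 0"
          by simp
      qed
    qed measurable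
    then show ?thesis by simp
  qed
  have Cauchy: "\<exists>N. \<forall>n\<ge>N. \<forall>m\<ge>N. L2_nn (\<lambda>x. u (r n) x - u (r m) x) < ennreal e" if e: "e > 0" for e
  proof -
    define c where "c = (2 * pi) ^ DIM('a)"
    have c: "c > 0" by (simp add: c_def)
    \<comment> \<open>The low-frequency terms will contribute \<open>c * e / 2\<close>. With this
      \<open>K\<close> the high-frequency terms contribute \<open>c * e / 2\<close> times
      \<open>C\<^sup>2 / (C\<^sup>2 + 1)\<close>; the \<open>+ 1\<close> gives strict inequality and
      keeps \<open>K\<close> positive when \<open>C = 0\<close>.\<close>
    define K where "K = 8 * (C\<^sup>2 + 1) / e"
    have K: "K > 0" using e by (simp add: K_def add_nonneg_pos)
    obtain \<rho> where "\<And>\<xi>. norm \<xi> \<ge> \<rho> \<Longrightarrow> levy_multiplier \<mu> \<xi> > K"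
      using lim[of K] unfolding eventually_at_infinity by blast
    then have \<rho>: "\<And>\<xi>. norm \<xi> > \<rho> \<Longrightarrow> levy_multiplier \<mu> \<xi> \<ge> K" by (meson less_imp_le)
    have "\<forall>\<^sub>F n in sequentially. a \<rho> n < ennreal (c * e / 8)"
      using order_tendstoD(2)[OF a] c e by simp
    then obtain N where N: "\<And>n. n \<ge> N \<Longrightarrow> a \<rho> n < ennreal (c * e / 8)"
      unfolding eventually_sequentially by blast
    have E: "(\<integral>\<^sup>+\<xi>. ennreal (levy_multiplier \<mu> \<xi> * (norm (fourier (u n) \<xi>))\<^sup>2) \<partial>lborel) \<le> ennreal (c * C\<^sup>2)" for n
    proof -
      have "(\<integral>\<^sup>+\<xi>. ennreal (levy_multiplier \<mu> \<xi> * (norm (fourier (u n) \<xi>))\<^sup>2) \<partial>lborel)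
          = ennreal c * (\<integral>\<^sup>+x. levy_B \<mu> (u n) x \<partial>lborel)"
        unfolding c_def by (rule levy_energy_eq_fourier[OF \<mu> uR, symmetric])
      also have "\<dots> \<le> ennreal c * ennreal (C\<^sup>2)" by (intro mult_left_mono H(3)) simp
      finally show ?thesis using c by (simp add: ennreal_mult)
    qed
    have "L2_nn (\<lambda>x. u (r n) x - u (r m) x) < ennreal e" if nm: "n \<ge> N" "m \<ge> N" for n m
    \<comment> \<open>Negating first lets the Plancherel constant \<open>c\<close> be multiplied in,
      instead of divided out in [0,\<infinity>].\<close>
    proof (rule ccontr)
      assume "\<not> L2_nn (\<lambda>x. u (r n) x - u (r m) x) < ennreal e"
      then have "ennreal c * ennreal e \<le> ennreal c * L2_nn (\<lambda>x. u (r n) x - u (r m) x)"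
        by (intro mult_left_mono) auto
      also have "\<dots> = (\<integral>\<^sup>+\<xi>. ennreal ((norm (fourier (\<lambda>x. u (r n) x - u (r m) x) \<xi>))\<^sup>2) \<partial>lborel)"
        unfolding c_def by (rule plancherel[OF L2_diff[OF uR uR], symmetric])
      also have "\<dots> = (\<integral>\<^sup>+\<xi>. ennreal ((norm (fourier (u (r n)) \<xi> - fourier (u (r m)) \<xi>))\<^sup>2) \<partial>lborel)"
        by (simp add: fourier_diff L2_integrable(1)[OF uR bounded_cball])
      also have "\<dots> \<le> 2 * a \<rho> n + 2 * a \<rho> m
          + ennreal (2 / K) * (\<integral>\<^sup>+\<xi>. ennreal (levy_multiplier \<mu> \<xi> * (norm (fourier (u (r n)) \<xi>))\<^sup>2) \<partial>lborel)
          + ennreal (2 / K) * (\<integral>\<^sup>+\<xi>. ennreal (levy_multiplier \<mu> \<xi> * (norm (fourier (u (r m)) \<xi>))\<^sup>2) \<partial>lborel)"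
        unfolding a_def
        by (rule nn_integral_diff_low_high_le) (use K \<rho> in \<open>auto simp: levy_multiplier_nonneg\<close>)
      also have "\<dots> \<le> 2 * ennreal (c * e / 8) + 2 * ennreal (c * e / 8)
          + ennreal (2 / K) * ennreal (c * C\<^sup>2) + ennreal (2 / K) * ennreal (c * C\<^sup>2)"
        by (intro add_mono mult_left_mono E less_imp_le[OF N] nm) auto
      also have "\<dots> = ennreal (c * e / 2 + 4 / K * (c * C\<^sup>2))"
        using c e K by (simp add: ennreal_mult[symmetric] ennreal_plus[symmetric] del: ennreal_plus flip: ennreal_numeral)
      also have "4 / K * (c * C\<^sup>2) = c * e / 2 * (C\<^sup>2 / (C\<^sup>2 + 1))"
      proof -
        have *: "4 / (8 * D / e) * (c * C\<^sup>2) = c * e / 2 * (C\<^sup>2 / D)" if "D > 0" for D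
          using e that by (simp add: field_simps)
        show ?thesis unfolding K_def by (rule *) (simp add: add_nonneg_pos)
      qed
      also have "ennreal (c * e / 2 + c * e / 2 * (C\<^sup>2 / (C\<^sup>2 + 1))) < ennreal (c * e)"
      proof -
        have "C\<^sup>2 / (C\<^sup>2 + 1) < 1" by (simp add: divide_less_eq add_nonneg_pos)
        then have "c * e / 2 * (C\<^sup>2 / (C\<^sup>2 + 1)) < c * e / 2 * 1"
          using c e by (intro mult_strict_left_mono) auto
        then have "c * e / 2 + c * e / 2 * (C\<^sup>2 / (C\<^sup>2 + 1)) < c * e" by linarith
        then show ?thesis by (rule ennreal_lessI[OF mult_pos_pos[OF c e]])
      qed
      also have "\<dots> = ennreal c * ennreal e" using c e by (simp add: ennreal_mult)
      finally show False by simp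
    qed
    then show ?thesis by blast
  qed
  \<comment> \<open>Completeness supplies a limit supported in \<open>\<Omega>\<close>, so the limit
    \<open>U\<close> of the transforms never has to be inverted.\<close>
  obtain v where v: "v \<in> L2 \<Omega>" and vlim: "(\<lambda>n. L2_nn (\<lambda>x. u (r n) x - v x)) \<longlonglongrightarrow> 0"
    using L2_complete[of "\<lambda>n. u (r n)", OF H(1) Cauchy] by metis
  have "L2_nn (u (r n) - v) < \<infinity>" for n
    using L2_diff[OF H(1) v, of "r n"] by (simp add: L2_def fun_diff_def)
  then have "(\<lambda>n. L2_norm (u (r n) - v)) \<longlonglongrightarrow> 0"
    using vlim by (simp add: L2_norm_tendsto_0_iff fun_diff_def)
  then show "\<exists>r v. strict_mono r \<and> v \<in> L2 \<Omega> \<and> (\<lambda>n. L2_norm (u (r n) - v)) \<longlonglongrightarrow> 0"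
    using r v by blast
qed

subsection \<open>Failure of compactness\<close>

text \<open>A cone of height \<open>\<rho>\<close> and slope 1: the slope bounds its increments by
  |z|, and a height of at most 1 bounds them by 1, which together match the weight in the Levy
  condition.\<close>

definition tent :: "'a::euclidean_space \<Rightarrow> real \<Rightarrow> 'a \<Rightarrow> real" where
  "tent x0 \<rho> x = max 0 (\<rho> - norm (x - x0))"

lemma borel_measurable_tent [measurable]: "tent x0 \<rho> \<in> borel_measurable borel"
  unfolding tent_def[abs_def] by measurable

lemma tent_bounds: "0 \<le> tent x0 \<rho> x" "\<rho> \<ge> 0 \<Longrightarrow> tent x0 \<rho> x \<le> \<rho> * indicator (cball x0 \<rho>) x"
  by (auto simp: tent_def indicator_def dist_norm norm_minus_commute)

lemma tent_lipschitz: "\<bar>tent x0 \<rho> x - tent x0 \<rho> y\<bar> \<le> norm (x - y)"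
  unfolding tent_def using norm_triangle_ineq3[of "x - x0" "y - x0"] by auto

lemma integrable_tent:
  assumes "\<rho> \<ge> 0"
  shows "integrable lborel (tent x0 \<rho>)" "integrable lborel (\<lambda>x. (tent x0 \<rho> x)\<^sup>2)"
proof -
  have int: "integrable lborel (\<lambda>x. c * indicator (cball x0 \<rho>) x)" for c :: real
    by (rule integrable_indicator_cball)
  show "integrable lborel (tent x0 \<rho>)"
    using int[of \<rho>] by (rule Bochner_Integration.integrable_bound)
      (use tent_bounds(1)[of x0 \<rho>] tent_bounds(2)[of \<rho> x0] assms in auto)
  show "integrable lborel (\<lambda>x. (tent x0 \<rho> x)\<^sup>2)"
    using int[of "\<rho>\<^sup>2"]
  proof (rule Bochner_Integration.integrable_bound)
    have "(tent x0 \<rho> x)\<^sup>2 \<le> \<rho>\<^sup>2 * indicator (cball x0 \<rho>) x" for x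
      using power_mono[OF tent_bounds(2)[OF assms, of x0 x] tent_bounds(1), of 2]
      by (auto simp: indicator_def)
    then show "AE x in lborel. norm ((tent x0 \<rho> x)\<^sup>2) \<le> norm (\<rho>\<^sup>2 * indicator (cball x0 \<rho>) x)"
      by (auto simp: abs_mult)
  qed measurable
qed

text \<open>On the ball of half the radius the tent is at least \<open>\<rho> / 2\<close>.\<close>

lemma integral_tent_sq_pos:
  assumes "\<rho> > 0"
  shows "(LINT x|lborel. (tent x0 \<rho> x)\<^sup>2) > 0"
proof -
  have int: "integrable lborel (\<lambda>x. (\<rho> / 2)\<^sup>2 * indicator (cball x0 (\<rho> / 2)) x)"
    by (rule integrable_indicator_cball)
  have "0 < (\<rho> / 2)\<^sup>2 * measure lborel (cball x0 (\<rho> / 2))"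
    using assms content_cball_pos[of "\<rho> / 2" x0] by simp
  also have "\<dots> = (LINT x|lborel. (\<rho> / 2)\<^sup>2 * indicator (cball x0 (\<rho> / 2)) x)"
    by simp
  also have "\<dots> \<le> (LINT x|lborel. (tent x0 \<rho> x)\<^sup>2)"
  proof (rule integral_mono[OF int integrable_tent(2)])
    fix x
    show "(\<rho> / 2)\<^sup>2 * indicator (cball x0 (\<rho> / 2)) x \<le> (tent x0 \<rho> x)\<^sup>2"
      using assms by (auto simp: indicator_def tent_def dist_norm norm_minus_commute intro!: power_mono)
  qed (use assms in simp)
  finally show ?thesis .
qed

text \<open>Shifting by half a wave length changes the sign of the cosine, so the integral is controlled
  by the modulus of continuity of \<open>f\<close>.\<close>

lemma abs_integral_cos_le:
  fixes f :: "'a::euclidean_space \<Rightarrow> real"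
  assumes f: "integrable lborel f" and h: "\<xi> \<bullet> h = pi"
  shows "2 * \<bar>LINT x|lborel. f x * cos (\<xi> \<bullet> x)\<bar> \<le> (LINT x|lborel. \<bar>f x - f (x + h)\<bar>)"
proof -
  have [measurable]: "f \<in> borel_measurable borel"
    using f by (auto dest: borel_measurable_integrable)
  note fh = integrable_lborel_shift[OF f, of h]
  let ?I = "LINT x|lborel. f x * cos (\<xi> \<bullet> x)"
  have "?I = (LINT x|lborel. f (x + h) * cos (\<xi> \<bullet> (x + h)))"
    by (rule integral_lborel_shift[of "\<lambda>x. f x * cos (\<xi> \<bullet> x)", symmetric]) measurable
  also have "\<dots> = (LINT x|lborel. - (f (x + h) * cos (\<xi> \<bullet> x)))"
    by (intro Bochner_Integration.integral_cong refl) (simp add: inner_add_right h)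
  finally have "2 * ?I = ?I - (LINT x|lborel. f (x + h) * cos (\<xi> \<bullet> x))" by simp
  also have "\<dots> = (LINT x|lborel. f x * cos (\<xi> \<bullet> x) - f (x + h) * cos (\<xi> \<bullet> x))"
    by (intro Bochner_Integration.integral_diff[symmetric] integrable_mult_cos_sin f fh)
  also have "\<dots> = (LINT x|lborel. (f x - f (x + h)) * cos (\<xi> \<bullet> x))"
    by (simp add: left_diff_distrib)
  finally have eq: "2 * ?I = (LINT x|lborel. (f x - f (x + h)) * cos (\<xi> \<bullet> x))" .
  have "\<bar>2 * ?I\<bar> \<le> (LINT x|lborel. \<bar>(f x - f (x + h)) * cos (\<xi> \<bullet> x)\<bar>)"
    unfolding eq using integral_norm_bound[of lborel "\<lambda>x. (f x - f (x + h)) * cos (\<xi> \<bullet> x)"] by simp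
  also have "\<dots> \<le> (LINT x|lborel. \<bar>f x - f (x + h)\<bar>)"
  proof (rule integral_mono)
    show "integrable lborel (\<lambda>x. \<bar>(f x - f (x + h)) * cos (\<xi> \<bullet> x)\<bar>)"
      by (intro integrable_abs integrable_mult_cos_sin Bochner_Integration.integrable_diff f fh)
    show "integrable lborel (\<lambda>x. \<bar>f x - f (x + h)\<bar>)"
      by (intro integrable_abs Bochner_Integration.integrable_diff f fh)
  qed (simp add: abs_mult mult_left_le)
  finally show ?thesis by (simp add: abs_mult)
qed

text \<open>The cosine transform of the squared bump. Its value at 0, the squared norm of the bump,
  is the main term in the distance between two waves.\<close>

definition tent_cos :: "'a::euclidean_space \<Rightarrow> real \<Rightarrow> 'a \<Rightarrow> real" where
  "tent_cos x0 \<rho> \<xi> = (LINT x|lborel. (tent x0 \<rho> x)\<^sup>2 * cos (\<xi> \<bullet> x))"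

text \<open>Riemann-Lebesgue with a rate: the half wave length is pi / |\<xi>|, and a difference of
  squares factors into a Lipschitz increment and an integrable sum.\<close>

lemma tent_cos_decay:
  assumes \<rho>: "0 \<le> \<rho>" and \<xi>: "\<xi> \<noteq> 0"
  shows "\<bar>tent_cos x0 \<rho> \<xi>\<bar> \<le> pi * (LINT x|lborel. tent x0 \<rho> x) / norm \<xi>"
proof -
  let ?\<phi> = "tent x0 \<rho>"
  note \<phi> = integrable_tent[OF \<rho>, of x0]
  \<comment> \<open>The shortest vector with \<open>\<xi> \<bullet> h = pi\<close>.\<close>
  define h where "h = (pi / (norm \<xi>)\<^sup>2) *\<^sub>R \<xi>"
  have h: "\<xi> \<bullet> h = pi" "norm h = pi / norm \<xi>"
    using \<xi> by (simp_all add: h_def dot_square_norm power2_eq_square)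
  note \<phi>h = integrable_lborel_shift[OF \<phi>(1), of h] integrable_lborel_shift[OF \<phi>(2), of h]
  have "2 * \<bar>tent_cos x0 \<rho> \<xi>\<bar> \<le> (LINT x|lborel. \<bar>(?\<phi> x)\<^sup>2 - (?\<phi> (x + h))\<^sup>2\<bar>)"
    unfolding tent_cos_def by (rule abs_integral_cos_le[OF \<phi>(2) h(1)])
  also have "\<dots> \<le> (LINT x|lborel. norm h * (?\<phi> x + ?\<phi> (x + h)))"
  proof (rule integral_mono)
    show "integrable lborel (\<lambda>x. \<bar>(?\<phi> x)\<^sup>2 - (?\<phi> (x + h))\<^sup>2\<bar>)"
      by (intro integrable_abs Bochner_Integration.integrable_diff \<phi> \<phi>h)
    show "integrable lborel (\<lambda>x. norm h * (?\<phi> x + ?\<phi> (x + h)))"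
      by (intro integrable_mult_right Bochner_Integration.integrable_add \<phi> \<phi>h)
    fix x
    have "\<bar>(?\<phi> x)\<^sup>2 - (?\<phi> (x + h))\<^sup>2\<bar> = \<bar>?\<phi> x - ?\<phi> (x + h)\<bar> * (?\<phi> x + ?\<phi> (x + h))"
      using tent_bounds(1)[of x0 \<rho> x] tent_bounds(1)[of x0 \<rho> "x + h"]
      by (simp add: abs_mult square_diff_square_factored power2_eq_square mult.commute)
    also have "\<dots> \<le> norm h * (?\<phi> x + ?\<phi> (x + h))"
      using tent_lipschitz[of x0 \<rho> x "x + h"] by (intro mult_right_mono add_nonneg_nonneg tent_bounds) auto
    finally show "\<bar>(?\<phi> x)\<^sup>2 - (?\<phi> (x + h))\<^sup>2\<bar> \<le> norm h * (?\<phi> x + ?\<phi> (x + h))" .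
  qed
  also have "\<dots> = 2 * (norm h * (LINT x|lborel. ?\<phi> x))"
    using \<phi>(1) \<phi>h(1) integral_lborel_shift[of ?\<phi> h] by simp
  finally show ?thesis by (simp add: h)
qed

definition wave :: "'a::euclidean_space \<Rightarrow> real \<Rightarrow> 'a \<Rightarrow> 'a \<Rightarrow> real" where
  "wave x0 \<rho> \<xi> x = tent x0 \<rho> x * cos (\<xi> \<bullet> x)"

lemma borel_measurable_wave [measurable]: "wave x0 \<rho> \<xi> \<in> borel_measurable borel"
  unfolding wave_def[abs_def] by measurable

lemma L2_nn_tent:
  assumes "\<rho> \<ge> 0"
  shows "L2_nn (tent x0 \<rho>) = ennreal (LINT x|lborel. (tent x0 \<rho> x)\<^sup>2)"
  unfolding L2_nn_def by (rule nn_integral_eq_integral) (auto intro: integrable_tent assms)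

lemma L2_nn_wave_le: "L2_nn (wave x0 \<rho> \<xi>) \<le> L2_nn (tent x0 \<rho>)"
  unfolding L2_nn_def wave_def
  by (intro nn_integral_mono ennreal_leI)
     (simp add: power_mult_distrib mult_left_le abs_square_le_1)

lemma wave_in_L2:
  assumes "\<rho> \<ge> 0" "cball x0 \<rho> \<subseteq> S"
  shows "wave x0 \<rho> \<xi> \<in> L2 S"
proof -
  have "L2_nn (wave x0 \<rho> \<xi>) < \<infinity>"
    using L2_nn_wave_le[of x0 \<rho> \<xi>] L2_nn_tent[OF assms(1), of x0] by (simp add: order_le_less_trans)
  moreover have "wave x0 \<rho> \<xi> x = 0" if "x \<notin> S" for x
  proof -
    have "x \<notin> cball x0 \<rho>" using that assms(2) by auto
    then show ?thesis by (simp add: wave_def tent_def dist_norm norm_minus_commute)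
  qed
  ultimately show ?thesis by (simp add: L2_def)
qed

text \<open>Product-to-sum formulas leave the main term \<open>tent_cos x0 \<rho> 0\<close> and
  corrections at doubled, difference and sum frequencies, all small once these frequencies are
  large.\<close>

lemma L2_nn_wave_diff:
  assumes \<rho>: "\<rho> \<ge> 0"
  shows "L2_nn (\<lambda>x. wave x0 \<rho> \<xi> x - wave x0 \<rho> \<eta> x) = ennreal (tent_cos x0 \<rho> 0
    + tent_cos x0 \<rho> (2 *\<^sub>R \<xi>) / 2 + tent_cos x0 \<rho> (2 *\<^sub>R \<eta>) / 2
    - tent_cos x0 \<rho> (\<xi> - \<eta>) - tent_cos x0 \<rho> (\<xi> + \<eta>))"
proof -
  let ?G = "\<lambda>\<xi> x. (tent x0 \<rho> x)\<^sup>2 * cos (\<xi> \<bullet> x)"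
  note G = integrable_mult_cos_sin(1)[OF integrable_tent(2)[OF \<rho>, of x0]]
  have eq: "(wave x0 \<rho> \<xi> x - wave x0 \<rho> \<eta> x)\<^sup>2
    = ?G 0 x + ?G (2 *\<^sub>R \<xi>) x / 2 + ?G (2 *\<^sub>R \<eta>) x / 2 - ?G (\<xi> - \<eta>) x - ?G (\<xi> + \<eta>) x" for x
  proof -
    have "(wave x0 \<rho> \<xi> x - wave x0 \<rho> \<eta> x)\<^sup>2
        = (tent x0 \<rho> x)\<^sup>2 * ((cos (\<xi> \<bullet> x))\<^sup>2 + (cos (\<eta> \<bullet> x))\<^sup>2 - 2 * (cos (\<xi> \<bullet> x) * cos (\<eta> \<bullet> x)))"
      by (simp add: wave_def power2_eq_square algebra_simps)
    also have "(cos (\<xi> \<bullet> x))\<^sup>2 = (1 + cos ((2 *\<^sub>R \<xi>) \<bullet> x)) / 2"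
      by (simp add: cos_double_cos)
    also have "(cos (\<eta> \<bullet> x))\<^sup>2 = (1 + cos ((2 *\<^sub>R \<eta>) \<bullet> x)) / 2"
      by (simp add: cos_double_cos)
    also have "2 * (cos (\<xi> \<bullet> x) * cos (\<eta> \<bullet> x)) = cos ((\<xi> - \<eta>) \<bullet> x) + cos ((\<xi> + \<eta>) \<bullet> x)"
      by (simp add: inner_diff_left inner_add_left cos_diff cos_add)
    finally show ?thesis by (simp add: field_simps)
  qed
  have "L2_nn (\<lambda>x. wave x0 \<rho> \<xi> x - wave x0 \<rho> \<eta> x) = ennreal (LINT x|lborel. (wave x0 \<rho> \<xi> x - wave x0 \<rho> \<eta> x)\<^sup>2)"
    by (rule L2_nn_eq_integral[OF L2_diff[OF wave_in_L2 wave_in_L2]]) (use \<rho> in auto)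
  also have "(LINT x|lborel. (wave x0 \<rho> \<xi> x - wave x0 \<rho> \<eta> x)\<^sup>2)
    = tent_cos x0 \<rho> 0 + tent_cos x0 \<rho> (2 *\<^sub>R \<xi>) / 2 + tent_cos x0 \<rho> (2 *\<^sub>R \<eta>) / 2
      - tent_cos x0 \<rho> (\<xi> - \<eta>) - tent_cos x0 \<rho> (\<xi> + \<eta>)"
    unfolding eq tent_cos_def
    by (simp add: G Bochner_Integration.integral_add Bochner_Integration.integral_diff
        del: inner_zero_left inner_scaleR_left)
  finally show ?thesis .
qed

section \<open>Energy bounds for modulated bumps\<close>

lemma cos_add_diff_sq_le:
  fixes a b :: real
  shows "(cos (a + b) - cos a)\<^sup>2 \<le> 2 * (1 - cos b)"
proof -
  have "cos (a + b) - cos a = Re (cis a * (cis b - 1))"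
    by (simp add: cos_add algebra_simps)
  then have "\<bar>cos (a + b) - cos a\<bar> \<le> norm (cis a * (cis b - 1))"
    by (simp only: abs_Re_le_cmod)
  then have "\<bar>cos (a + b) - cos a\<bar>\<^sup>2 \<le> (norm (cis a * (cis b - 1)))\<^sup>2"
    by (intro power_mono) auto
  then show ?thesis by (simp add: norm_mult norm_cis_minus_one_sq)
qed

text \<open>The increment is at most |z| by the Lipschitz bound and at most 1 because the values lie
  in [0,1]. It vanishes unless \<open>x\<close> or \<open>x + z\<close> is in the ball, hence the
  factor 2.\<close>

lemma L2_nn_tent_shift_le:
  fixes z :: "'a::euclidean_space"
  assumes \<rho>: "0 \<le> \<rho>" "\<rho> \<le> 1"
  shows "L2_nn (\<lambda>x. tent x0 \<rho> (x + z) - tent x0 \<rho> x)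
    \<le> 2 * emeasure lborel (cball x0 \<rho>) * ennreal (min ((norm z)\<^sup>2) 1)"
proof -
  let ?m = "min ((norm z)\<^sup>2) 1"
  let ?I = "indicator (cball x0 \<rho>) :: 'a \<Rightarrow> ennreal"
  have [measurable]: "cball x0 \<rho> \<in> sets borel" by simp
  have "L2_nn (\<lambda>x. tent x0 \<rho> (x + z) - tent x0 \<rho> x)
      \<le> (\<integral>\<^sup>+x. ennreal ?m * (?I (x + z) + ?I x) \<partial>lborel)"
    unfolding L2_nn_def
  proof (rule nn_integral_mono)
    fix x
    let ?d = "tent x0 \<rho> (x + z) - tent x0 \<rho> x"
    have "\<bar>?d\<bar> \<le> norm z" using tent_lipschitz[of x0 \<rho> "x + z" x] by simp
    then have 1: "?d\<^sup>2 \<le> (norm z)\<^sup>2" by (intro abs_le_square_iff[THEN iffD1]) simp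
    have b: "0 \<le> tent x0 \<rho> y" "tent x0 \<rho> y \<le> 1" for y
      using \<rho> norm_ge_zero[of "y - x0"] by (auto simp: tent_def simp del: norm_ge_zero)
    have "\<bar>?d\<bar> \<le> \<bar>1\<bar>" using b[of x] b[of "x + z"] by auto
    then have 2: "?d\<^sup>2 \<le> 1" by (subst (asm) abs_le_square_iff) simp
    show "ennreal (?d\<^sup>2) \<le> ennreal ?m * (?I (x + z) + ?I x)"
    proof (cases "x \<in> cball x0 \<rho> \<or> x + z \<in> cball x0 \<rho>")
      case True
      then have "1 \<le> ?I (x + z) + ?I x" by (auto simp: indicator_def)
      have "ennreal (?d\<^sup>2) \<le> ennreal ?m * 1" using 1 2 by (simp add: ennreal_leI)
      also have "\<dots> \<le> ennreal ?m * (?I (x + z) + ?I x)"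
        by (rule mult_left_mono[OF \<open>1 \<le> ?I (x + z) + ?I x\<close>]) simp
      finally show ?thesis .
    next
      case False
      then have "?d = 0" by (auto simp: tent_def dist_norm norm_minus_commute)
      then show ?thesis by simp
    qed
  qed
  also have "\<dots> = ennreal ?m * ((\<integral>\<^sup>+x. ?I (x + z) \<partial>lborel) + (\<integral>\<^sup>+x. ?I x \<partial>lborel))"
    by (simp add: nn_integral_cmult nn_integral_add)
  also have "\<dots> = 2 * emeasure lborel (cball x0 \<rho>) * ennreal ?m"
    using nn_integral_lborel_shift[of ?I z] by (simp add: mult_2 mult.commute)
  finally show ?thesis .
qed

text \<open>Discrete product rule: the increment of the bump times the shifted cosine, plus the bump
  times the increment of the cosine, estimated by \<open>cos_add_diff_sq_le\<close>.\<close>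

lemma L2_nn_wave_shift_le:
  fixes z :: "'a::euclidean_space"
  shows "L2_nn (\<lambda>x. wave x0 \<rho> \<xi> (x + z) - wave x0 \<rho> \<xi> x)
    \<le> 2 * L2_nn (\<lambda>x. tent x0 \<rho> (x + z) - tent x0 \<rho> x) + 4 * ennreal (1 - cos (\<xi> \<bullet> z)) * L2_nn (tent x0 \<rho>)"
proof -
  let ?\<phi> = "tent x0 \<rho>"
  let ?c = "\<lambda>x. cos (\<xi> \<bullet> x)"
  have "L2_nn (\<lambda>x. wave x0 \<rho> \<xi> (x + z) - wave x0 \<rho> \<xi> x)
      = L2_nn (\<lambda>x. (?\<phi> (x + z) - ?\<phi> x) * ?c (x + z) + ?\<phi> x * (?c (x + z) - ?c x))"
    by (simp add: wave_def algebra_simps)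
  also have "\<dots> \<le> 2 * L2_nn (\<lambda>x. (?\<phi> (x + z) - ?\<phi> x) * ?c (x + z)) + 2 * L2_nn (\<lambda>x. ?\<phi> x * (?c (x + z) - ?c x))"
    by (rule L2_nn_add_le) measurable
  also have "\<dots> \<le> 2 * L2_nn (\<lambda>x. ?\<phi> (x + z) - ?\<phi> x) + 2 * (2 * ennreal (1 - cos (\<xi> \<bullet> z)) * L2_nn ?\<phi>)"
  proof (intro add_mono mult_left_mono)
    show "L2_nn (\<lambda>x. (?\<phi> (x + z) - ?\<phi> x) * ?c (x + z)) \<le> L2_nn (\<lambda>x. ?\<phi> (x + z) - ?\<phi> x)"
      unfolding L2_nn_def
      by (intro nn_integral_mono ennreal_leI) (simp add: power_mult_distrib mult_left_le abs_square_le_1)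
    have "L2_nn (\<lambda>x. ?\<phi> x * (?c (x + z) - ?c x)) \<le> (\<integral>\<^sup>+x. ennreal (2 * (1 - cos (\<xi> \<bullet> z))) * ennreal ((?\<phi> x)\<^sup>2) \<partial>lborel)"
      unfolding L2_nn_def
    proof (rule nn_integral_mono)
      fix x
      have "(?\<phi> x * (?c (x + z) - ?c x))\<^sup>2 \<le> 2 * (1 - cos (\<xi> \<bullet> z)) * (?\<phi> x)\<^sup>2"
        using mult_left_mono[OF cos_add_diff_sq_le[of "\<xi> \<bullet> x" "\<xi> \<bullet> z"] zero_le_power2[of "?\<phi> x"]]
        by (simp add: power_mult_distrib inner_add_right mult.commute)
      then have "ennreal ((?\<phi> x * (?c (x + z) - ?c x))\<^sup>2) \<le> ennreal (2 * (1 - cos (\<xi> \<bullet> z)) * (?\<phi> x)\<^sup>2)"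
        by (rule ennreal_leI)
      also have "\<dots> = ennreal (2 * (1 - cos (\<xi> \<bullet> z))) * ennreal ((?\<phi> x)\<^sup>2)"
        by (rule ennreal_mult) auto
      finally show "ennreal ((?\<phi> x * (?c (x + z) - ?c x))\<^sup>2) \<le> ennreal (2 * (1 - cos (\<xi> \<bullet> z))) * ennreal ((?\<phi> x)\<^sup>2)" .
    qed
    also have "\<dots> = ennreal (2 * (1 - cos (\<xi> \<bullet> z))) * L2_nn ?\<phi>"
      unfolding L2_nn_def by (rule nn_integral_cmult) measurable
    also have "\<dots> = 2 * ennreal (1 - cos (\<xi> \<bullet> z)) * L2_nn ?\<phi>"
      by (subst ennreal_mult) auto
    finally show "L2_nn (\<lambda>x. ?\<phi> x * (?c (x + z) - ?c x)) \<le> 2 * ennreal (1 - cos (\<xi> \<bullet> z)) * L2_nn ?\<phi>" .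
  qed auto
  also have "2 * (2 * ennreal (1 - cos (\<xi> \<bullet> z)) * L2_nn ?\<phi>) = 4 * ennreal (1 - cos (\<xi> \<bullet> z)) * L2_nn ?\<phi>"
    by (simp add: mult.assoc[symmetric])
  finally show ?thesis .
qed

text \<open>The point is uniformity: \<open>D\<close> sees the frequency only through the bound
  \<open>K\<close> on the multiplier.\<close>

lemma H0_nn_wave_bounded:
  fixes \<mu> :: "'a::euclidean_space measure"
  assumes \<mu>: "symmetric_levy_measure \<mu>" and \<rho>: "0 \<le> \<rho>" "\<rho> \<le> 1"
  obtains D where "D < \<infinity>" "\<And>\<xi>. levy_multiplier \<mu> \<xi> \<le> K \<Longrightarrow> H0_nn \<mu> (wave x0 \<rho> \<xi>) \<le> D"
proof
  note [measurable_cong] = symmetric_levy_measureD(1)[OF \<mu>]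
  let ?N = "L2_nn (tent x0 \<rho>)" and ?b = "emeasure lborel (cball x0 \<rho>)"
  let ?W = "\<integral>\<^sup>+z. ennreal (min ((norm z)\<^sup>2) 1) \<partial>\<mu>"
  let ?D = "?N + (1 / 2) * (4 * ?b * ?W + 4 * ennreal K * ?N)"
  have half: "(1 / 2 :: ennreal) < top"
    using divide_ennreal[of 1 2] unfolding ennreal_1 ennreal_numeral by (metis ennreal_less_top zero_less_numeral zero_le_one)
  show "?D < \<infinity>"
    using symmetric_levy_measureD(4)[OF \<mu>] L2_nn_tent[OF \<rho>(1), of x0] half emeasure_lborel_cball_finite[of x0 \<rho>]
    by (simp add: ennreal_mult_less_top)
  fix \<xi> :: 'a assume K: "levy_multiplier \<mu> \<xi> \<le> K"
  let ?w = "wave x0 \<rho> \<xi>"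
  have "(\<integral>\<^sup>+z. L2_nn (\<lambda>x. ?w (x + z) - ?w x) \<partial>\<mu>)
      \<le> (\<integral>\<^sup>+z. 4 * ?b * ennreal (min ((norm z)\<^sup>2) 1) + 4 * ennreal (1 - cos (\<xi> \<bullet> z)) * ?N \<partial>\<mu>)"
  proof (rule nn_integral_mono)
    fix z
    have "L2_nn (\<lambda>x. ?w (x + z) - ?w x)
      \<le> 2 * L2_nn (\<lambda>x. tent x0 \<rho> (x + z) - tent x0 \<rho> x) + 4 * ennreal (1 - cos (\<xi> \<bullet> z)) * ?N"
      by (rule L2_nn_wave_shift_le)
    also have "\<dots> \<le> 2 * (2 * ?b * ennreal (min ((norm z)\<^sup>2) 1)) + 4 * ennreal (1 - cos (\<xi> \<bullet> z)) * ?N"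
      by (intro add_mono mult_left_mono L2_nn_tent_shift_le \<rho>) auto
    also have "\<dots> = 4 * ?b * ennreal (min ((norm z)\<^sup>2) 1) + 4 * ennreal (1 - cos (\<xi> \<bullet> z)) * ?N"
      by (simp add: mult.assoc[symmetric])
    finally show "L2_nn (\<lambda>x. ?w (x + z) - ?w x)
      \<le> 4 * ?b * ennreal (min ((norm z)\<^sup>2) 1) + 4 * ennreal (1 - cos (\<xi> \<bullet> z)) * ?N" .
  qed
  also have "\<dots> = 4 * ?b * ?W + 4 * ennreal (levy_multiplier \<mu> \<xi>) * ?N"
    by (simp add: nn_integral_add nn_integral_cmult nn_integral_multc nn_integral_one_minus_cos[OF \<mu>])
  also have "\<dots> \<le> 4 * ?b * ?W + 4 * ennreal K * ?N"
    by (intro add_mono mult_left_mono mult_right_mono ennreal_leI K) auto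
  finally have "(\<integral>\<^sup>+z. L2_nn (\<lambda>x. ?w (x + z) - ?w x) \<partial>\<mu>) \<le> 4 * ?b * ?W + 4 * ennreal K * ?N" .
  then show "H0_nn \<mu> ?w \<le> ?D"
    unfolding H0_nn_def nn_integral_levy_B[OF \<mu> borel_measurable_wave]
    by (intro add_mono mult_left_mono L2_nn_wave_le) auto
qed

theorem multiplier_tendsto_if_compact_embedding:
  fixes \<mu> :: "'a::euclidean_space measure"
  assumes \<mu>: "symmetric_levy_measure \<mu>" and \<Omega>: "open \<Omega>" "\<Omega> \<noteq> {}"
    and compact: "compact_embedding (H0 \<mu> \<Omega>) (H0_norm \<mu>) (L2 \<Omega>) L2_norm"
  shows "\<forall>\<^sub>F \<xi> in at_infinity. levy_multiplier \<mu> \<xi> > K"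
proof (rule ccontr)
  assume "\<not> ?thesis"
  then have "\<forall>n::nat. \<exists>\<xi>. norm \<xi> \<ge> real n \<and> levy_multiplier \<mu> \<xi> \<le> K"
    unfolding eventually_at_infinity by (meson not_less)
  from choice[OF this]
  obtain \<xi> where \<xi>: "\<And>n::nat. norm (\<xi> n) \<ge> real n" "\<And>n. levy_multiplier \<mu> (\<xi> n) \<le> K"
    by blast
  obtain x0 where "x0 \<in> \<Omega>" using \<Omega>(2) by blast
  then obtain \<rho>' where \<rho>': "\<rho>' > 0" "cball x0 \<rho>' \<subseteq> \<Omega>" using \<Omega>(1) open_contains_cball by blast
  \<comment> \<open>Capped at 1, as the energy bound requires.\<close>
  define \<rho> where "\<rho> = min \<rho>' 1"
  have \<rho>: "0 < \<rho>" "0 \<le> \<rho>" "\<rho> \<le> 1" "cball x0 \<rho> \<subseteq> \<Omega>"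
    using \<rho>' by (auto simp: \<rho>_def)
  define w where "w n = wave x0 \<rho> (\<xi> n)" for n
  have wL2: "w n \<in> L2 \<Omega>" for n unfolding w_def by (rule wave_in_L2[OF \<rho>(2,4)])
  obtain D where D: "D < \<infinity>" "\<And>n. H0_nn \<mu> (w n) \<le> D"
    using H0_nn_wave_bounded[OF \<mu> \<rho>(2,3), of K x0] \<xi>(2) unfolding w_def by metis
  have "w n \<in> H0 \<mu> \<Omega>" "H0_norm \<mu> (w n) \<le> sqrt (enn2real D)" for n
    using wL2 D order_le_less_trans[OF D(2) D(1)]
    by (auto simp: H0_def H0_norm_def intro!: enn2real_mono)
  then obtain r v where r: "strict_mono r" and v: "v \<in> L2 \<Omega>"
    and "(\<lambda>n. L2_norm (w (r n) - v)) \<longlonglongrightarrow> 0"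
    using compact unfolding compact_embedding_def by metis
  moreover have "L2_nn (w (r n) - v) < \<infinity>" for n
    using L2_diff[OF wL2 v, of "r n"] by (simp add: L2_def fun_diff_def)
  ultimately have lim: "(\<lambda>n. L2_nn (\<lambda>x. w (r n) x - v x)) \<longlonglongrightarrow> 0"
    by (simp add: L2_norm_tendsto_0_iff fun_diff_def)
  have [measurable]: "w n \<in> borel_measurable borel" "v \<in> borel_measurable borel" for n
    using wL2[of n] v by (auto simp: L2_def)
  let ?F = "tent_cos x0 \<rho>"
  define F0 where "F0 = ?F 0"
  have F0: "F0 > 0" unfolding F0_def tent_cos_def using integral_tent_sq_pos[OF \<rho>(1)] by simp
  define T where "T = (LINT x|lborel. tent x0 \<rho> x)"
  have T: "T \<ge> 0" unfolding T_def by (rule integral_nonneg_AE) (simp add: tent_bounds)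
  \<comment> \<open>Chosen so that \<open>pi * T / b\<close> is at most \<open>F0 / 8\<close>; the
    \<open>+ 1\<close> makes \<open>b\<close> positive from \<open>T \<ge> 0\<close> alone.\<close>
  define b where "b = 8 * pi * T / F0 + 1"
  have b: "b > 0" using F0 T by (simp add: b_def add_nonneg_pos)
  have small: "\<bar>?F \<eta>\<bar> \<le> F0 / 8" if "norm \<eta> \<ge> b" for \<eta>
  proof -
    have "norm \<eta> > 0" using that b by linarith
    then have "\<bar>?F \<eta>\<bar> \<le> pi * T / norm \<eta>"
      unfolding T_def using tent_cos_decay[OF \<rho>(2), of \<eta> x0] by auto
    also have "\<dots> \<le> pi * T / b"
      using that b T \<open>norm \<eta> > 0\<close> by (intro divide_left_mono mult_pos_pos) auto
    also have "\<dots> \<le> F0 / 8"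
      using F0 T b by (simp add: b_def field_simps)
    finally show ?thesis .
  qed
  \<comment> \<open>Two waves this close to \<open>v\<close> have squared distance at most
    \<open>F0 / 4\<close>, whereas corrections of size \<open>F0 / 8\<close> in the distance formula
    leave at least 5/8 of \<open>F0\<close>.\<close>
  obtain N where N: "\<And>n. n \<ge> N \<Longrightarrow> L2_nn (\<lambda>x. w (r n) x - v x) < ennreal (F0 / 16)"
    using order_tendstoD(2)[OF lim, of "ennreal (F0 / 16)"] F0
    unfolding eventually_sequentially by auto
  have large: "\<exists>n\<ge>N. norm (\<xi> (r n)) \<ge> B" for B
  proof -
    obtain k :: nat where "B \<le> real k" using real_arch_simple by blast
    also have "\<dots> \<le> real (r (max N k))" using seq_suble[OF r, of "max N k"] by simp
    also have "\<dots> \<le> norm (\<xi> (r (max N k)))" by (rule \<xi>(1))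
    finally show ?thesis by (intro exI[of _ "max N k"]) simp
  qed
  obtain n where n: "n \<ge> N" "norm (\<xi> (r n)) \<ge> b" using large by blast
  \<comment> \<open>The gap \<open>b\<close> between the norms forces both the sum and the
    difference of the two frequencies to have norm at least \<open>b\<close>.\<close>
  obtain m where m: "m \<ge> N" "norm (\<xi> (r m)) \<ge> norm (\<xi> (r n)) + b" using large by blast
  let ?p = "\<xi> (r n)" and ?q = "\<xi> (r m)"
  have "L2_nn (\<lambda>x. w (r n) x - w (r m) x) = L2_nn (\<lambda>x. (w (r n) x - v x) - (w (r m) x - v x))"
    by simp
  also have "\<dots> \<le> 2 * L2_nn (\<lambda>x. w (r n) x - v x) + 2 * L2_nn (\<lambda>x. w (r m) x - v x)"
    by (rule L2_nn_diff_le) measurable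
  also have "\<dots> \<le> 2 * ennreal (F0 / 16) + 2 * ennreal (F0 / 16)"
    by (intro add_mono mult_left_mono less_imp_le[OF N] n m) auto
  also have "\<dots> = ennreal (F0 / 4)"
    using F0 by (simp add: ennreal_plus[symmetric] ennreal_mult[symmetric] del: ennreal_plus flip: ennreal_numeral)
  finally have "ennreal (F0 + ?F (2 *\<^sub>R ?p) / 2 + ?F (2 *\<^sub>R ?q) / 2 - ?F (?p - ?q) - ?F (?p + ?q)) \<le> ennreal (F0 / 4)"
    unfolding w_def L2_nn_wave_diff[OF \<rho>(2)] F0_def .
  \<comment> \<open>\<open>ennreal\<close> truncates negative values to 0, which is harmless because
    the right side is nonnegative.\<close>
  then have "F0 + ?F (2 *\<^sub>R ?p) / 2 + ?F (2 *\<^sub>R ?q) / 2 - ?F (?p - ?q) - ?F (?p + ?q) \<le> F0 / 4"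
    using F0 by (subst (asm) ennreal_le_iff) auto
  moreover have "\<bar>?F (2 *\<^sub>R ?p)\<bar> \<le> F0 / 8" "\<bar>?F (2 *\<^sub>R ?q)\<bar> \<le> F0 / 8"
    "\<bar>?F (?p - ?q)\<bar> \<le> F0 / 8" "\<bar>?F (?p + ?q)\<bar> \<le> F0 / 8"
  proof -
    show "\<bar>?F (2 *\<^sub>R ?p)\<bar> \<le> F0 / 8" using n(2) b by (intro small) simp
    show "\<bar>?F (2 *\<^sub>R ?q)\<bar> \<le> F0 / 8" using n(2) m(2) b by (intro small) simp
    show "\<bar>?F (?p - ?q)\<bar> \<le> F0 / 8"
      using norm_triangle_ineq2[of ?q ?p] m(2) by (intro small) (simp add: norm_minus_commute)
    show "\<bar>?F (?p + ?q)\<bar> \<le> F0 / 8"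
      using norm_diff_ineq[of ?q ?p] m(2) by (intro small) (simp add: add.commute)
  qed
  ultimately show False using F0 by linarith
qed

theorem proposition4p5:
  fixes \<Omega> :: "'a::euclidean_space set"
    and L :: "('a \<Rightarrow> real) \<Rightarrow> 'a \<Rightarrow> real"
    and \<mu> :: "'a measure"
  assumes "\<Omega> \<noteq> {}" and "bounded \<Omega>" and "open \<Omega>"
    and "symmetric_levy_operator L \<mu>"
  shows "compact_embedding (H0 \<mu> \<Omega>) (H0_norm \<mu>) (L2 \<Omega>) L2_norm \<longleftrightarrow>
    Liminf at_infinity (\<lambda>\<xi>. ereal (levy_multiplier \<mu> \<xi>)) = \<infinity>"
proof -
  have \<mu>: "symmetric_levy_measure \<mu>"
    using assms(4) by (simp add: symmetric_levy_operator_def)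
  \<comment> \<open>\<open>at_infinity\<close> is a proper filter on a Euclidean space, so an
    infinite lower limit is the same as divergence to infinity.\<close>
  have "Liminf at_infinity (\<lambda>\<xi>. ereal (levy_multiplier \<mu> \<xi>)) = \<infinity>
      \<longleftrightarrow> ((\<lambda>\<xi>. ereal (levy_multiplier \<mu> \<xi>)) \<longlongrightarrow> \<infinity>) at_infinity"
    by (rule Liminf_PInfty[OF trivial_limit_at_infinity, symmetric])
  also have "\<dots> \<longleftrightarrow> (\<forall>K. \<forall>\<^sub>F \<xi> in at_infinity. levy_multiplier \<mu> \<xi> > K)"
    by (simp add: tendsto_PInfty)
  finally show ?thesis
    using compact_embedding_if_multiplier_tendsto[OF \<mu> assms(2)]
      multiplier_tendsto_if_compact_embedding[OF \<mu> assms(3,1)] by blast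
qed

end
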